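(* Define $\mathcal{D}=\mathrm{GL}^+(3,\mathbb{R})\times\mathbb{M}^3$. If $\gamma>4/3$, then for any $(A_1,A_0)\in\mathcal{D}$ there exists a unique solution $A\in C(\mathbb{R},\mathrm{GL}^+(3,\mathbb{R}))\cap C^\infty(\mathbb{R},\mathbb{M}^3)$ of $$A''(t)=(\det A(t))^{1-\gamma}A(t)^{-\top}$$ such that $$\lim_{t\to\infty}\|A(t)-(A_0+tA_1)\|=0.$$ Define a mapping $\mathcal{W}_+:\mathcal{D}\to\mathcal{D}$ by $\mathcal{W}_+(A_1,A_0)=(A(0),A'(0))$, where $A$ is this solution. If $4/3<\gamma<2$, then $\mathcal{W}_+$ is a bijection.
   Context: $\mathbb{M}^3$ is the space of real $3\times3$ matrices with operator norm $\|\cdot\|$, $\mathrm{GL}^+(3,\mathbb{R})=\{A\in\mathbb{M}^3:\det A>0\}$, $A^{-\top}=(A^{-1})^\top$. *)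

theory Defs
  imports "HOL-Analysis.Analysis"
begin

definition GL_plus :: "(real^3^3) set" where
  "GL_plus = {A. det A > 0}"

definition data_space :: "((real^3^3) \<times> (real^3^3)) set" where
  "data_space = GL_plus \<times> UNIV"

text \<open>The library norm on the type of real 3 by 3 matrices is the Frobenius norm.
  The operator norm is the one induced by the Euclidean norm on column vectors.\<close>

definition op_norm :: "real^3^3 \<Rightarrow> real" where
  "op_norm M = onorm (\<lambda>x. M *v x)"

definition time_deriv :: "(real \<Rightarrow> 'a::real_normed_vector) \<Rightarrow> real \<Rightarrow> 'a" where
  "time_deriv f = (\<lambda>t. vector_derivative f (at t))"

text \<open>Since \<^const>\<open>vector_derivative\<close> is an arbitrary value at points of
  non-differentiability, smoothness demands that every iterated derivative is
  differentiable everywhere (hence also continuous).\<close>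

definition C_infinity :: "(real \<Rightarrow> 'a::real_normed_vector) \<Rightarrow> bool" where
  "C_infinity f \<longleftrightarrow> (\<forall>n t. (time_deriv ^^ n) f differentiable (at t))"

definition is_global_solution :: "real \<Rightarrow> (real \<Rightarrow> real^3^3) \<Rightarrow> bool" where
  "is_global_solution \<gamma> A \<longleftrightarrow>
     continuous_on UNIV A \<and> range A \<subseteq> GL_plus \<and> C_infinity A \<and>
     (\<forall>t. time_deriv (time_deriv A) t =
            (det (A t) powr (1 - \<gamma>)) *\<^sub>R transpose (matrix_inv (A t)))"

definition asymptotic_to :: "(real \<Rightarrow> real^3^3) \<Rightarrow> real^3^3 \<Rightarrow> real^3^3 \<Rightarrow> bool" where
  "asymptotic_to A A\<^sub>1 A\<^sub>0 \<longleftrightarrow>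
     ((\<lambda>t. op_norm (A t - (A\<^sub>0 + t *\<^sub>R A\<^sub>1))) \<longlongrightarrow> 0) at_top"

text \<open>The order of the pair follows the asymptotic data: first the velocity, which lies in
  \<^const>\<open>GL_plus\<close>, then the translation. The value is meaningful only where the
  solution exists uniquely.\<close>

definition wave_plus ::
    "real \<Rightarrow> (real^3^3) \<times> (real^3^3) \<Rightarrow> (real^3^3) \<times> (real^3^3)" where
  "wave_plus \<gamma> = (\<lambda>(A\<^sub>1, A\<^sub>0).
     let A = (THE A. is_global_solution \<gamma> A \<and> asymptotic_to A A\<^sub>1 A\<^sub>0)
     in (A 0, time_deriv A 0))"

end

theory Submission
  imports Defs
begin

text \<open>
  The right-hand side \<open>F(A) = (det A) powr (1 - \<gamma>) * A\<^sup>-\<^sup>T = (det A) powr (- \<gamma>) * cof A\<close> is minus the gradient of the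
  potential \<open>U(A) = (det A) powr (1 - \<gamma>) / (\<gamma> - 1)\<close> and is positively homogeneous of degree \<open>2 - 3\<gamma>\<close>.
  These two facts carry the whole proof.

  Homogeneity makes infinity an ordinary initial time. Put \<open>B(s) = s A(1/s)\<close>. Then \<open>A'' = F(A)\<close>
  becomes \<open>B'' = s powr (3\<gamma> - 5) * F(B)\<close> on \<open>s > 0\<close> (\<open>motion_inversion\<close>), and
  \<open>A(t) - (A\<^sub>0 + t A\<^sub>1) \<rightarrow> 0\<close> as \<open>t \<rightarrow> \<infinity>\<close> says exactly that \<open>B(0) = A\<^sub>1\<close> and \<open>B'(0) = A\<^sub>0\<close>
  (\<open>asymptotic_to_iff_quotient\<close>). The weight \<open>s powr (3\<gamma> - 5)\<close> is integrable at \<open>0\<close> precisely when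
  \<open>\<gamma> > 4/3\<close>, so the scattering problem is an initial value problem with an integrable weight. Such
  problems are solved by Picard iteration (\<open>solves_ivp_exists\<close>, \<open>solves_ivp_unique\<close>); the same
  results with weight \<open>1\<close> serve the original equation.

  Conservation of \<open>|A'|\<^sup>2 / 2 + U(A)\<close> bounds \<open>A'\<close> from above and \<open>det A\<close> from below, so no solution
  breaks down in finite time (\<open>motion_exists\<close>). Hence the solution found near infinity extends to
  the whole line, and the wave operator is defined and injective (\<open>asymptotic_motion_exists\<close>,
  \<open>asymptotic_motion_unique\<close>). Smoothness is a bootstrap (\<open>motion_imp_global_solution\<close>).

  For surjectivity every solution must have asymptotic data with \<open>det A\<^sub>1 > 0\<close>
  (\<open>motion_has_asymptotic_data\<close>). With \<open>b = 3\<gamma> - 5\<close> the energy \<open>e(s) = |B'|\<^sup>2 / 2 + s powr b * U(B)\<close>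
  satisfies \<open>e' = b * s powr (b - 1) * U(B)\<close>, so \<open>s powr k * e(s)\<close> is nondecreasing for \<open>k = max 0 (-b)\<close>. This
  bounds \<open>U(B)\<close> by a multiple of \<open>s powr (- m)\<close> with \<open>m = max b 0\<close>, that is, \<open>det B \<ge> c * s powr q\<close> with
  \<open>q = m / (\<gamma> - 1)\<close>. The condition \<open>\<gamma> < 2\<close> is used as \<open>q < 1\<close>. It has two effects: \<open>B''\<close> is
  integrable, so that \<open>B\<close> extends differentiably to \<open>s = 0\<close>; and \<open>det B(0) = 0\<close> is impossible,
  because \<open>det B\<close> would then be \<open>O(s)\<close>, which is smaller than \<open>c * s powr q\<close> for small \<open>s\<close>.
\<close>

section \<open>Second-order initial value problems with an integrable weight\<close>

lemma integrable_weight_scaleR: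
  fixes g :: "real \<Rightarrow> 'a::euclidean_space"
  assumes w: "w integrable_on {a..b}" "\<And>s. s \<in> {a..b} \<Longrightarrow> 0 \<le> w s"
    and g: "continuous_on {a..b} g"
  shows "(\<lambda>s. w s *\<^sub>R g s) integrable_on {a..b}"
proof -
  have "w absolutely_integrable_on {a..b}"
    using w by (intro nonnegative_absolutely_integrable_1) auto
  moreover have "bilinear (\<lambda>(x::'a) (c::real). c *\<^sub>R x)"
    by (auto simp: bilinear_def algebra_simps intro!: linearI)
  moreover have "g \<in> borel_measurable (lebesgue_on {a..b})"
    by (rule continuous_imp_measurable_on_sets_lebesgue[OF g]) auto
  moreover have "bounded (g ` {a..b})"
    by (intro compact_imp_bounded compact_continuous_image g compact_Icc)
  ultimately have "(\<lambda>s. w s *\<^sub>R g s) absolutely_integrable_on {a..b}"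
    using absolutely_integrable_bounded_measurable_product[of "\<lambda>(x::'a) (c::real). c *\<^sub>R x" g "{a..b}" w]
    by simp
  then show ?thesis
    using absolutely_integrable_on_def by blast
qed

text \<open>Two integrations gain a factor \<open>1 / K\<close> against the weight \<open>exp (K r)\<close>: the inner integral costs
the mass of \<open>w\<close>, the outer one integrates the exponential. Making \<open>K\<close> large therefore turns the
Picard map into a contraction on the whole interval at once, whatever the singularity of \<open>w\<close>.\<close>
lemma double_integral_exp_bound:
  fixes h :: "real \<Rightarrow> 'a::euclidean_space"
  assumes h: "h integrable_on {0..T}" and w: "w integrable_on {0..T}"
    and w0: "\<And>r. r \<in> {0..T} \<Longrightarrow> 0 \<le> w r" and K: "K > 0" and c: "0 \<le> c"
    and hw: "\<And>r. r \<in> {0..T} \<Longrightarrow> norm (h r) \<le> w r * (c * exp (K * r))"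
    and t: "t \<in> {0..T}"
  shows "norm (integral {0..t} (\<lambda>s. integral {0..s} h))
    \<le> integral {0..T} w * c / K * exp (K * t)"
proof -
  define W where "W = integral {0..T} w"
  have W0: "0 \<le> W"
    unfolding W_def by (intro integral_nonneg w) (use w0 in auto)
  have inner_bound: "norm (integral {0..s} h) \<le> W * c * exp (K * s)" if s: "s \<in> {0..T}" for s
  proof -
    have ws: "w integrable_on {0..s}" and hs: "h integrable_on {0..s}"
      using integrable_subinterval_real[OF w] integrable_subinterval_real[OF h] s by auto
    have "norm (integral {0..s} h) \<le> integral {0..s} (\<lambda>r. w r * (c * exp (K * s)))"
    proof (rule integral_norm_bound_integral[OF hs])
      show "(\<lambda>r. w r * (c * exp (K * s))) integrable_on {0..s}"
        by (rule integrable_on_mult_left[OF ws])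
      fix r assume r: "r \<in> {0..s}"
      have "norm (h r) \<le> w r * (c * exp (K * r))"
        using hw r s by auto
      also have "\<dots> \<le> w r * (c * exp (K * s))"
        using r s c K w0 by (intro mult_left_mono) auto
      finally show "norm (h r) \<le> w r * (c * exp (K * s))" .
    qed
    also have "\<dots> = integral {0..s} w * (c * exp (K * s))"
      by simp
    also have "\<dots> \<le> W * (c * exp (K * s))"
      unfolding W_def
      by (intro mult_right_mono integral_subset_le) (use ws w s w0 c in auto)
    finally show ?thesis by (simp add: mult.assoc)
  qed
  have E: "((\<lambda>s. W * c * exp (K * s)) has_integral (W * c / K * exp (K * t) - W * c / K * exp (K * 0))) {0..t}"
    using t K
    by (intro fundamental_theorem_of_calculus)
       (auto intro!: derivative_eq_intros simp flip: has_real_derivative_iff_has_vector_derivative)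
  have "norm (integral {0..t} (\<lambda>s. integral {0..s} h)) \<le> integral {0..t} (\<lambda>s. W * c * exp (K * s))"
  proof (rule integral_norm_bound_integral)
    show "(\<lambda>s. integral {0..s} h) integrable_on {0..t}"
      by (rule integrable_continuous_real, rule continuous_on_subset[OF indefinite_integral_continuous_1[OF h]])
         (use t in auto)
    show "(\<lambda>s. W * c * exp (K * s)) integrable_on {0..t}"
      using E by blast
  qed (use inner_bound t in auto)
  also have "\<dots> = W * c / K * exp (K * t) - W * c / K"
    using integral_unique[OF E] by simp
  also have "\<dots> \<le> W * c / K * exp (K * t)"
    using W0 c K by simp
  finally show ?thesis unfolding W_def .
qed

lemma exp_weight_le: "exp (- K * s) * n \<le> m \<longleftrightarrow> n \<le> m * exp (K * s)" for K s n m :: real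
  by (simp add: exp_minus divide_simps mult.commute)

text \<open>A position \<open>Z\<close> and its velocity \<open>V\<close> for the problem \<open>Z'' = w G(Z)\<close>. The equation for the velocity
is integrated because \<open>w\<close> may be singular at \<open>0\<close>, where \<open>V\<close> then need not have a derivative.\<close>
definition solves_ivp ::
  "(real \<Rightarrow> real) \<Rightarrow> ('a::euclidean_space \<Rightarrow> 'a) \<Rightarrow> real \<Rightarrow> 'a \<Rightarrow> 'a \<Rightarrow> (real \<Rightarrow> 'a) \<Rightarrow> (real \<Rightarrow> 'a) \<Rightarrow> bool"
  where "solves_ivp w G T z0 v0 Z V \<longleftrightarrow> Z 0 = z0 \<and>
    (\<forall>t\<in>{0..T}. (Z has_vector_derivative V t) (at t within {0..T}) \<and>
       ((\<lambda>s. w s *\<^sub>R G (Z s)) has_integral (V t - v0)) {0..t})"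

lemma solves_ivp_continuous:
  assumes "solves_ivp w G T z0 v0 Z V"
  shows "continuous_on {0..T} Z" and "continuous_on {0..T} V"
proof -
  show "continuous_on {0..T} Z"
    using assms unfolding solves_ivp_def
    by (meson continuous_on_eq_continuous_within has_vector_derivative_continuous)
  have V: "V t = v0 + integral {0..t} (\<lambda>s. w s *\<^sub>R G (Z s))" if "t \<in> {0..T}" for t
  proof -
    have "((\<lambda>s. w s *\<^sub>R G (Z s)) has_integral (V t - v0)) {0..t}"
      using assms that unfolding solves_ivp_def by blast
    from integral_unique[OF this] show ?thesis by simp
  qed
  show "continuous_on {0..T} V"
  proof (cases "0 \<le> T")
    case True
    then have "(\<lambda>s. w s *\<^sub>R G (Z s)) integrable_on {0..T}"
      using assms unfolding solves_ivp_def by (meson atLeastAtMost_iff has_integral_integrable order_refl)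
    then have "continuous_on {0..T} (\<lambda>t. v0 + integral {0..t} (\<lambda>s. w s *\<^sub>R G (Z s)))"
      by (intro continuous_intros indefinite_integral_continuous_1)
    then show ?thesis
      using V by (metis (no_types, lifting) continuous_on_cong)
  qed auto
qed

lemma solves_ivp_initial_velocity:
  assumes "solves_ivp w G T z0 v0 Z V" "0 \<le> T"
  shows "V 0 = v0"
proof -
  have "((\<lambda>s. w s *\<^sub>R G (Z s)) has_integral (V 0 - v0)) {0..0}"
  proof -
    have "0 \<in> {0..T}" using assms by simp
    with assms show ?thesis unfolding solves_ivp_def by blast
  qed
  moreover have "((\<lambda>s. w s *\<^sub>R G (Z s)) has_integral 0) {0..0}"
    by (rule has_integral_null_real) simp
  ultimately have "V 0 - v0 = 0"
    by (rule has_integral_unique)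
  then show ?thesis by simp
qed

lemma solves_ivp_subinterval:
  assumes "solves_ivp w G T z0 v0 Z V" "S \<le> T"
  shows "solves_ivp w G S z0 v0 Z V"
  using assms unfolding solves_ivp_def
  by (auto intro: has_vector_derivative_within_subset[where S = "{0..T}"])

lemma solves_ivp_cong:
  assumes Z: "solves_ivp w G T z0 v0 Z V"
    and eq: "\<And>t. t \<in> {0..T} \<Longrightarrow> G (Z t) = G' (Z t)"
  shows "solves_ivp w G' T z0 v0 Z V"
proof -
  have "((\<lambda>s. w s *\<^sub>R G' (Z s)) has_integral (V t - v0)) {0..t}" if t: "t \<in> {0..T}" for t
  proof (rule has_integral_eq)
    show "((\<lambda>s. w s *\<^sub>R G (Z s)) has_integral (V t - v0)) {0..t}"
      using Z t unfolding solves_ivp_def by blast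
  qed (use eq t in auto)
  then show ?thesis
    using Z unfolding solves_ivp_def by blast
qed

lemma solves_ivp_double_integral:
  assumes "solves_ivp w G T z0 v0 Z V" "t \<in> {0..T}"
  shows "Z t = z0 + t *\<^sub>R v0 + integral {0..t} (\<lambda>s. integral {0..s} (\<lambda>r. w r *\<^sub>R G (Z r)))"
proof -
  have V: "V s = v0 + integral {0..s} (\<lambda>r. w r *\<^sub>R G (Z r))" if "s \<in> {0..T}" for s
  proof -
    have "((\<lambda>r. w r *\<^sub>R G (Z r)) has_integral (V s - v0)) {0..s}"
      using assms that unfolding solves_ivp_def by blast
    from integral_unique[OF this] show ?thesis by simp
  qed
  have sub: "{0..t} \<subseteq> {0..T}" using assms by auto
  have Vi: "(V has_integral Z t - Z 0) {0..t}"
    using assms sub unfolding solves_ivp_def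
    by (intro fundamental_theorem_of_calculus)
       (auto intro: has_vector_derivative_within_subset[where S = "{0..T}"])
  have "((\<lambda>s. V s - v0) has_integral (Z t - Z 0 - (t - 0) *\<^sub>R v0)) {0..t}"
    using Vi has_integral_const_real[of v0 0 t] assms by (intro has_integral_diff) auto
  then have "((\<lambda>s. integral {0..s} (\<lambda>r. w r *\<^sub>R G (Z r))) has_integral (Z t - Z 0 - t *\<^sub>R v0)) {0..t}"
    unfolding diff_zero by (rule has_integral_eq[rotated]) (use V sub in auto)
  from integral_unique[OF this] show ?thesis
    using assms unfolding solves_ivp_def by simp
qed

text \<open>The maximum \<open>m\<close> of \<open>exp (- K s) |Z1 s - Z2 s|\<close> satisfies \<open>m \<le> (L W / K) m\<close>, where \<open>W\<close> is the mass of
the weight, and \<open>K\<close> is chosen to make the factor less than one.\<close>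
proposition solves_ivp_unique:
  fixes G :: "'a::euclidean_space \<Rightarrow> 'a"
  assumes lip: "L-lipschitz_on X G"
    and w: "w integrable_on {0..T}" "\<And>s. s \<in> {0..T} \<Longrightarrow> 0 \<le> w s"
    and 1: "solves_ivp w G T z0 v0 Z1 V1" "Z1 ` {0..T} \<subseteq> X"
    and 2: "solves_ivp w G T z0 v0 Z2 V2" "Z2 ` {0..T} \<subseteq> X"
    and t: "t \<in> {0..T}"
  shows "Z1 t = Z2 t \<and> V1 t = V2 t"
proof -
  define h where "h = (\<lambda>r. w r *\<^sub>R G (Z1 r) - w r *\<^sub>R G (Z2 r))"
  define W where "W = integral {0..T} w"
  \<comment> \<open>This makes \<open>L * W / K\<close> less than \<open>1/2\<close>; the summand \<open>1\<close> keeps \<open>K\<close> positive.\<close>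
  define K where "K = 2 * L * W + 1"
  have L0: "0 \<le> L" using lip by (rule lipschitz_on_nonneg)
  have W0: "0 \<le> W" unfolding W_def by (intro integral_nonneg w) (use w in auto)
  have K0: "K > 0" using L0 W0 unfolding K_def by (simp add: add_nonneg_pos)
  have int: "(\<lambda>r. w r *\<^sub>R G (Z r)) integrable_on {0..s}"
    if "solves_ivp w G T z0 v0 Z V" "s \<in> {0..T}" for Z V s
    using that unfolding solves_ivp_def by blast
  have T: "0 \<le> T" using t by auto
  have Icont: "continuous_on {0..T} (\<lambda>s. integral {0..s} (\<lambda>r. w r *\<^sub>R G (Z r)))"
    if "solves_ivp w G T z0 v0 Z V" for Z V
    using int[OF that, of T] T by (intro indefinite_integral_continuous_1) auto
  have cont: "continuous_on {0..T} (\<lambda>s. exp (- K * s) * norm (Z1 s - Z2 s))"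
    by (intro continuous_intros solves_ivp_continuous[OF 1(1)] solves_ivp_continuous[OF 2(1)])
  obtain x where x: "x \<in> {0..T}"
    and mx: "\<And>s. s \<in> {0..T} \<Longrightarrow> exp (- K * s) * norm (Z1 s - Z2 s) \<le> exp (- K * x) * norm (Z1 x - Z2 x)"
    using continuous_attains_sup[OF compact_Icc _ cont] T by auto
  define m where "m = exp (- K * x) * norm (Z1 x - Z2 x)"
  have m0: "0 \<le> m" unfolding m_def by simp
  have bd: "norm (Z1 s - Z2 s) \<le> m * exp (K * s)" if "s \<in> {0..T}" for s
    using mx[OF that] unfolding exp_weight_le m_def .
  have hb: "norm (h r) \<le> w r * (L * m * exp (K * r))" if r: "r \<in> {0..T}" for r
  proof -
    have "norm (h r) = w r * norm (G (Z1 r) - G (Z2 r))"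
      unfolding h_def using w r by (simp flip: scaleR_diff_right)
    also have "\<dots> \<le> w r * (L * norm (Z1 r - Z2 r))"
      using lipschitz_on_normD[OF lip, of "Z1 r" "Z2 r"] 1(2) 2(2) r w
      by (intro mult_left_mono) (auto simp: image_subset_iff)
    also have "\<dots> \<le> w r * (L * (m * exp (K * r)))"
      using bd[OF r] w r L0 by (intro mult_left_mono) auto
    finally show ?thesis by (simp add: mult.assoc)
  qed
  have hint: "h integrable_on {0..T}"
    unfolding h_def using int[OF 1(1)] int[OF 2(1)] T by (intro integrable_diff) auto
  have "Z1 x - Z2 x = integral {0..x} (\<lambda>s. integral {0..s} (\<lambda>r. w r *\<^sub>R G (Z1 r)))
      - integral {0..x} (\<lambda>s. integral {0..s} (\<lambda>r. w r *\<^sub>R G (Z2 r)))"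
    using solves_ivp_double_integral[OF 1(1) x] solves_ivp_double_integral[OF 2(1) x] by simp
  also have "\<dots> = integral {0..x} (\<lambda>s. integral {0..s} (\<lambda>r. w r *\<^sub>R G (Z1 r)) - integral {0..s} (\<lambda>r. w r *\<^sub>R G (Z2 r)))"
    using x
    by (intro integral_diff [symmetric] integrable_continuous_real
          continuous_on_subset[OF Icont[OF 1(1)]] continuous_on_subset[OF Icont[OF 2(1)]]) auto
  also have "\<dots> = integral {0..x} (\<lambda>s. integral {0..s} h)"
    unfolding h_def using x int[OF 1(1)] int[OF 2(1)]
    by (intro integral_cong integral_diff [symmetric]) auto
  finally have "norm (Z1 x - Z2 x) \<le> W * (L * m) / K * exp (K * x)"
    using double_integral_exp_bound[OF hint w K0 _ hb x] L0 m0 unfolding W_def by simp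
  then have "m \<le> W * (L * m) / K"
    unfolding m_def exp_weight_le .
  then have "m * K \<le> W * L * m"
    using K0 by (simp add: field_simps)
  then have "m * (L * W + 1) \<le> 0"
    unfolding K_def by (simp add: algebra_simps)
  then have "m = 0"
    using m0 L0 W0 by (smt (verit) mult_nonneg_nonneg mult_le_0_iff)
  then have eqZ: "Z1 s = Z2 s" if "s \<in> {0..T}" for s
    using bd[OF that] by simp
  have "((\<lambda>s. w s *\<^sub>R G (Z1 s)) has_integral (V1 t - v0)) {0..t}"
       "((\<lambda>s. w s *\<^sub>R G (Z2 s)) has_integral (V2 t - v0)) {0..t}"
    using 1 2 t unfolding solves_ivp_def by auto
  moreover from this(1) have "((\<lambda>s. w s *\<^sub>R G (Z2 s)) has_integral (V1 t - v0)) {0..t}"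
    by (rule has_integral_eq[rotated]) (use eqZ t in auto)
  ultimately have "V1 t = V2 t"
    by (metis diff_add_cancel has_integral_unique)
  with eqZ t show ?thesis by blast
qed

text \<open>Banach's fixed point theorem for the unknown \<open>y(s) = exp (- K s) Z(s)\<close>, in the supremum norm. The
step size does not have to be small, so no continuation argument is needed.\<close>
proposition solves_ivp_exists:
  fixes G :: "'a::euclidean_space \<Rightarrow> 'a"
  assumes lip: "L-lipschitz_on UNIV G"
    and w: "w integrable_on {0..T}" "\<And>s. s \<in> {0..T} \<Longrightarrow> 0 \<le> w s"
    and T: "0 \<le> T"
  shows "\<exists>Z V. solves_ivp w G T z0 v0 Z V"
proof -
  define W where "W = integral {0..T} w"
  define K where "K = 2 * L * W + 1"
  have L0: "0 \<le> L" using lip by (rule lipschitz_on_nonneg)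
  have W0: "0 \<le> W" unfolding W_def by (intro integral_nonneg w) (use w in auto)
  have K0: "K > 0" using L0 W0 unfolding K_def by (simp add: add_nonneg_pos)
  define H where "H = (\<lambda>(y::real \<Rightarrow>\<^sub>C 'a) r. w r *\<^sub>R G (exp (K * r) *\<^sub>R y r))"
  define Q where "Q = (\<lambda>y t. z0 + t *\<^sub>R v0 + integral {0..t} (\<lambda>s. integral {0..s} (H y)))"
  \<comment> \<open>Bounded continuous functions live on the whole line; clamping time to the interval
      carries the Picard map \<open>Q\<close> over to them.\<close>
  define c where "c = (\<lambda>t. max 0 (min T t))"
  have c: "c t \<in> {0..T}" for t using T unfolding c_def by auto
  have cT: "c t = t" if "t \<in> {0..T}" for t using that unfolding c_def by auto
  have contG: "continuous_on UNIV G"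
    using lip lipschitz_on_continuous_on by blast
  have Hint: "H y integrable_on {0..T}" for y
    unfolding H_def
    by (intro integrable_weight_scaleR w continuous_on_compose2[OF contG] continuous_intros) auto
  have Icont: "continuous_on {0..T} (\<lambda>s. integral {0..s} (H y))" for y
    by (rule indefinite_integral_continuous_1[OF Hint])
  have Qcont: "continuous_on {0..T} (\<lambda>t. exp (- K * t) *\<^sub>R Q y t)" for y
    unfolding Q_def
    by (intro continuous_intros indefinite_integral_continuous_1 integrable_continuous_real Icont)
  have bc: "(\<lambda>t. exp (- K * c t) *\<^sub>R Q y (c t)) \<in> bcontfun" for y
  proof -
    have "bounded ((\<lambda>t. exp (- K * t) *\<^sub>R Q y t) ` {0..T})"
      by (intro compact_imp_bounded compact_continuous_image Qcont compact_Icc)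
    then obtain b where "\<forall>x\<in>(\<lambda>t. exp (- K * t) *\<^sub>R Q y t) ` {0..T}. norm x \<le> b"
      by (meson bounded_iff)
    then have b: "norm (exp (- K * t) *\<^sub>R Q y t) \<le> b" if "t \<in> {0..T}" for t
      using that by blast
    show ?thesis
    proof (rule bcontfun_normI)
      have "continuous_on UNIV c" unfolding c_def by (intro continuous_intros)
      then show "continuous_on UNIV (\<lambda>t. exp (- K * c t) *\<^sub>R Q y (c t))"
        by (rule continuous_on_compose2[OF Qcont]) (use c in auto)
      show "norm (exp (- K * c t) *\<^sub>R Q y (c t)) \<le> b" for t
        by (rule b[OF c])
    qed
  qed
  define P where "P = (\<lambda>y. Bcontfun (\<lambda>t. exp (- K * c t) *\<^sub>R Q y (c t)))"
  have P: "P y t = exp (- K * c t) *\<^sub>R Q y (c t)" for y t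
    unfolding P_def by (subst Bcontfun_inverse[OF bc]) (rule refl)
  have contr: "dist (P y) (P y') \<le> 1/2 * dist y y'" for y y'
  proof (rule dist_bound)
    fix t
    define m where "m = dist y y'"
    have t: "c t \<in> {0..T}" by (rule c)
    have hb: "norm (H y r - H y' r) \<le> w r * (L * m * exp (K * r))" if r: "r \<in> {0..T}" for r
    proof -
      have "norm (H y r - H y' r) = w r * norm (G (exp (K * r) *\<^sub>R y r) - G (exp (K * r) *\<^sub>R y' r))"
        unfolding H_def using w r by (simp flip: scaleR_diff_right)
      also have "\<dots> \<le> w r * (L * norm (exp (K * r) *\<^sub>R y r - exp (K * r) *\<^sub>R y' r))"
        using lipschitz_on_normD[OF lip] r w by (intro mult_left_mono) auto
      also have "norm (exp (K * r) *\<^sub>R y r - exp (K * r) *\<^sub>R y' r) = exp (K * r) * dist (y r) (y' r)"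
        by (simp add: dist_norm flip: scaleR_diff_right)
      also have "w r * (L * (exp (K * r) * dist (y r) (y' r))) \<le> w r * (L * (exp (K * r) * m))"
        unfolding m_def using L0 w r by (intro mult_left_mono dist_bounded) auto
      finally show ?thesis by (simp add: mult_ac)
    qed
    have hint: "(\<lambda>r. H y r - H y' r) integrable_on {0..T}"
      by (intro integrable_diff Hint)
    have sub: "{0..c t} \<subseteq> {0..T}" using t by auto
    have "Q y (c t) - Q y' (c t)
        = integral {0..c t} (\<lambda>s. integral {0..s} (H y)) - integral {0..c t} (\<lambda>s. integral {0..s} (H y'))"
      unfolding Q_def by simp
    also have "\<dots> = integral {0..c t} (\<lambda>s. integral {0..s} (H y) - integral {0..s} (H y'))"
      using sub by (intro integral_diff [symmetric] integrable_continuous_real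
         continuous_on_subset[OF Icont]) auto
    also have "\<dots> = integral {0..c t} (\<lambda>s. integral {0..s} (\<lambda>r. H y r - H y' r))"
      using sub by (intro integral_cong integral_diff [symmetric] integrable_subinterval_real[OF Hint]) auto
    finally have "norm (Q y (c t) - Q y' (c t)) \<le> W * (L * m) / K * exp (K * c t)"
      using double_integral_exp_bound[OF hint w K0 _ hb t] L0 unfolding W_def m_def by simp
    then have "dist (P y t) (P y' t) \<le> W * (L * m) / K"
      unfolding P dist_norm scaleR_diff_right[symmetric] norm_scaleR abs_exp_cancel exp_weight_le .
    also have "\<dots> \<le> 1/2 * m"
    proof -
      have "0 \<le> m" unfolding m_def by simp
      then show ?thesis
        using K0 unfolding K_def by (simp add: field_simps)
    qed
    finally show "dist (P y t) (P y' t) \<le> 1/2 * dist y y'" unfolding m_def .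
  qed
  obtain y where y: "P y = y"
    using banach_fix_type[of "1/2" P] contr by auto
  define Z where "Z = Q y"
  define V where "V = (\<lambda>s. v0 + integral {0..s} (H y))"
  have ZH: "H y r = w r *\<^sub>R G (Z r)" if "r \<in> {0..T}" for r
  proof -
    have "y r = exp (- K * r) *\<^sub>R Q y r"
      using P[of y r] cT[OF that] y by simp
    then have "exp (K * r) *\<^sub>R y r = Z r"
      unfolding Z_def by (simp flip: exp_add)
    then show ?thesis unfolding H_def by simp
  qed
  have "solves_ivp w G T z0 v0 Z V"
    unfolding solves_ivp_def
  proof (intro conjI ballI)
    show "Z 0 = z0" unfolding Z_def Q_def by simp
    fix t assume t: "t \<in> {0..T}"
    have "((\<lambda>u. integral {0..u} (\<lambda>s. integral {0..s} (H y))) has_vector_derivative integral {0..t} (H y)) (at t within {0..T})"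
      by (rule integral_has_vector_derivative[OF Icont t])
    then show "(Z has_vector_derivative V t) (at t within {0..T})"
      unfolding Z_def Q_def V_def
      by (auto intro!: derivative_eq_intros)
    have "(H y has_integral (integral {0..t} (H y))) {0..t}"
      by (intro integrable_integral integrable_subinterval_real[OF Hint]) (use t in auto)
    then show "((\<lambda>s. w s *\<^sub>R G (Z s)) has_integral (V t - v0)) {0..t}"
      unfolding V_def add_diff_cancel_left'
      by (rule has_integral_eq[rotated]) (use t ZH in auto)
  qed
  then show ?thesis by blast
qed

section \<open>The force field on matrices of positive determinant\<close>

text \<open>The cofactor matrix, row by row. Cross products make it visibly bilinear in the rows, which
gives its Lipschitz bounds without any calculus.\<close>
definition cof :: "real^3^3 \<Rightarrow> real^3^3" where
  "cof A = vector [cross3 (A$2) (A$3), cross3 (A$3) (A$1), cross3 (A$1) (A$2)]"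

lemma cof_rows:
  "cof A $ 1 = cross3 (A$2) (A$3)" "cof A $ 2 = cross3 (A$3) (A$1)" "cof A $ 3 = cross3 (A$1) (A$2)"
  by (simp_all add: cof_def)

lemma det_row_cross: "det A = (A$1) \<bullet> cross3 (A$2) (A$3)" for A :: "real^3^3"
  by (simp add: cross3_simps)

lemma matrix_mult_transpose_cof: "A ** transpose (cof A) = det A *\<^sub>R mat 1"
  by (simp add: vec_eq_iff matrix_matrix_mult_def forall_3 sum_3 mat_def transpose_def
      cof_rows cross3_def det_3 algebra_simps)

lemma transpose_matrix_inv_eq_cof:
  assumes "det A \<noteq> 0"
  shows "transpose (matrix_inv A) = (1 / det A) *\<^sub>R cof A"
proof -
  define B where "B = (1 / det A) *\<^sub>R transpose (cof A)"
  have "A ** B = (1 / det A) *\<^sub>R (A ** transpose (cof A))"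
    unfolding B_def
    by (simp add: vec_eq_iff matrix_matrix_mult_def sum_distrib_left mult.left_commute sum_divide_distrib)
  then have AB: "A ** B = mat 1"
    using assms by (simp add: matrix_mult_transpose_cof)
  then have BA: "B ** A = mat 1"
    by (simp add: matrix_left_right_inverse)
  have "A ** matrix_inv A = mat 1"
    unfolding matrix_inv_def by (rule someI2[of _ B]) (use AB BA in auto)
  then have "matrix_inv A = B"
    using BA by (metis matrix_mul_assoc matrix_mul_lid matrix_mul_rid)
  then show ?thesis
    unfolding B_def by (simp add: transpose_def vec_eq_iff)
qed

text \<open>The right-hand side of the equation of motion, written with cofactors instead of the inverse: the power of
the determinant is then the only factor that is singular.\<close>
definition force :: "real \<Rightarrow> real^3^3 \<Rightarrow> real^3^3" where
  "force \<gamma> A = det A powr (- \<gamma>) *\<^sub>R cof A"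

definition potential :: "real \<Rightarrow> real^3^3 \<Rightarrow> real" where
  "potential \<gamma> A = det A powr (1 - \<gamma>) / (\<gamma> - 1)"

lemma force_eq:
  assumes "A \<in> GL_plus"
  shows "det A powr (1 - \<gamma>) *\<^sub>R transpose (matrix_inv A) = force \<gamma> A"
proof -
  have d: "det A > 0" using assms by (simp add: GL_plus_def)
  then have "det A powr (1 - \<gamma>) * (1 / det A) = det A powr (- \<gamma>)"
    by (simp add: powr_diff powr_minus divide_simps)
  then show ?thesis
    using d by (simp add: transpose_matrix_inv_eq_cof force_def)
qed

lemma det_scaleR: "det (c *\<^sub>R A) = c ^ 3 * det A" for A :: "real^3^3"
  by (simp add: det_3 algebra_simps power3_eq_cube)

lemma cof_scaleR: "cof (c *\<^sub>R A) = c\<^sup>2 *\<^sub>R cof A"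
  by (simp add: vec_eq_iff forall_3 cof_rows cross3_def algebra_simps power2_eq_square)

lemma force_scaleR:
  assumes "c > 0" "A \<in> GL_plus"
  shows "force \<gamma> (c *\<^sub>R A) = c powr (2 - 3 * \<gamma>) *\<^sub>R force \<gamma> A"
proof -
  have "(c ^ 3 * det A) powr (- \<gamma>) = c powr (- 3 * \<gamma>) * det A powr (- \<gamma>)"
    using assms by (simp add: GL_plus_def powr_mult powr_powr flip: powr_numeral)
  moreover have "c powr (- 3 * \<gamma>) * c\<^sup>2 = c powr (2 - 3 * \<gamma>)"
    using assms by (simp add: powr_add flip: powr_numeral powr_add)
  ultimately show ?thesis
    unfolding force_def det_scaleR cof_scaleR by (simp add: mult_ac)
qed

lemma GL_plus_scaleR: "c > 0 \<Longrightarrow> A \<in> GL_plus \<Longrightarrow> c *\<^sub>R A \<in> GL_plus"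
  by (simp add: GL_plus_def det_scaleR)

lemma continuous_on_det3 [continuous_intros]:
  "continuous_on S f \<Longrightarrow> continuous_on S (\<lambda>x. det (f x :: real^3^3))"
  unfolding det_3 by (intro continuous_intros)

lemma three_cases: "P 1 \<Longrightarrow> P 2 \<Longrightarrow> P 3 \<Longrightarrow> P i" for i :: 3
  using exhaust_3[of i] by auto

lemma continuous_on_cof [continuous_intros]:
  fixes f :: "'a::t2_space \<Rightarrow> real^3^3"
  assumes "continuous_on S f" shows "continuous_on S (\<lambda>x. cof (f x))"
proof -
  have "continuous_on S (\<lambda>x. cof (f x) $ i)" for i
    by (rule three_cases[of "\<lambda>i. continuous_on S (\<lambda>x. cof (f x) $ i)"])
       (simp_all add: cof_rows continuous_on_cross assms continuous_intros)
  then have "continuous_on S (\<lambda>x. \<chi> i. cof (f x) $ i)"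
    by (rule continuous_on_vec_lambda)
  then show ?thesis by simp
qed

lemma continuous_on_force:
  fixes f :: "'a::t2_space \<Rightarrow> real^3^3"
  assumes "continuous_on S f" "f ` S \<subseteq> GL_plus"
  shows "continuous_on S (\<lambda>x. force \<gamma> (f x))"
  unfolding force_def
  by (intro continuous_intros assms) (use assms(2) in \<open>auto simp: GL_plus_def\<close>)

lemma has_vector_derivative_matrix_entry:
  fixes Z :: "real \<Rightarrow> real^3^3"
  assumes "(Z has_vector_derivative V) F"
  shows "((\<lambda>t. Z t $ i $ j) has_real_derivative V $ i $ j) F"
  using bounded_linear.has_vector_derivative[OF bounded_linear_vec_nth
      bounded_linear.has_vector_derivative[OF bounded_linear_vec_nth assms]]
  by (simp add: has_real_derivative_iff_has_vector_derivative)

text \<open>Jacobi's formula: the cofactor matrix is the gradient of the determinant.\<close>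
lemma det_has_derivative:
  fixes Z :: "real \<Rightarrow> real^3^3"
  assumes "(Z has_vector_derivative V) (at t within S)"
  shows "((\<lambda>t. det (Z t)) has_real_derivative cof (Z t) \<bullet> V) (at t within S)"
  unfolding det_3
  by (rule derivative_eq_intros has_vector_derivative_matrix_entry[OF assms] refl)+
     (simp add: inner_vec_def sum_3 cof_rows cross3_def algebra_simps)

lemma potential_has_derivative:
  fixes Z :: "real \<Rightarrow> real^3^3"
  assumes "(Z has_vector_derivative V) (at t within S)" "Z t \<in> GL_plus" "\<gamma> \<noteq> 1"
  shows "((\<lambda>t. potential \<gamma> (Z t)) has_real_derivative - (force \<gamma> (Z t) \<bullet> V)) (at t within S)"
proof -
  have d: "det (Z t) > 0" using assms(2) by (simp add: GL_plus_def)
  have "((\<lambda>t. det (Z t) powr (1 - \<gamma>)) has_real_derivative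
      (1 - \<gamma>) * det (Z t) powr (- \<gamma>) * (cof (Z t) \<bullet> V)) (at t within S)"
    using d by (auto intro!: derivative_eq_intros det_has_derivative[OF assms(1)])
  from DERIV_cdivide[OF this, of "\<gamma> - 1"] show ?thesis
    unfolding potential_def force_def
    by (rule DERIV_cong) (use assms(3) in \<open>simp add: field_simps\<close>)
qed

text \<open>The force does exactly the work that the potential loses, so the energy changes only through an
explicit time dependence of the weight.\<close>
lemma energy_has_derivative:
  fixes Z V :: "real \<Rightarrow> real^3^3"
  assumes "(Z has_vector_derivative V t) (at t within S)"
    and "(V has_vector_derivative w t *\<^sub>R force \<gamma> (Z t)) (at t within S)"
    and "(w has_real_derivative w') (at t within S)" "Z t \<in> GL_plus" "\<gamma> \<noteq> 1"
  shows "((\<lambda>t. (V t \<bullet> V t) / 2 + w t * potential \<gamma> (Z t)) has_real_derivative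
           w' * potential \<gamma> (Z t)) (at t within S)"
proof -
  have "((\<lambda>t. V t \<bullet> V t) has_real_derivative 2 * w t * (force \<gamma> (Z t) \<bullet> V t)) (at t within S)"
    using bounded_bilinear.has_vector_derivative[OF bounded_bilinear_inner assms(2,2)]
    by (simp add: has_real_derivative_iff_has_vector_derivative inner_commute mult.assoc)
  from DERIV_add[OF DERIV_cdivide[OF this, of 2]
      DERIV_mult[OF assms(3) potential_has_derivative[OF assms(1,4,5)]]]
  show ?thesis by simp
qed

lemma lipschitz_on_bounded_bilinear:
  fixes f :: "'x::heine_borel \<Rightarrow> 'a::euclidean_space" and g :: "'x \<Rightarrow> 'b::euclidean_space"
    and b :: "'a \<Rightarrow> 'b \<Rightarrow> 'c::real_normed_vector"
  assumes "bounded_bilinear b" "bounded S"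
    and f: "\<exists>L. L-lipschitz_on S f" and g: "\<exists>L. L-lipschitz_on S g"
  shows "\<exists>L. L-lipschitz_on S (\<lambda>x. b (f x) (g x))"
proof -
  interpret bounded_bilinear b by fact
  obtain K where K: "K \<ge> 0" "\<And>x y. norm (b x y) \<le> norm x * norm y * K"
    using nonneg_bounded by blast
  obtain Lf Lg where Lf: "Lf-lipschitz_on S f" and Lg: "Lg-lipschitz_on S g"
    using f g by blast
  have "bounded (f ` S)" "bounded (g ` S)"
    using bounded_uniformly_continuous_image[OF lipschitz_on_uniformly_continuous[OF Lf] assms(2)]
      bounded_uniformly_continuous_image[OF lipschitz_on_uniformly_continuous[OF Lg] assms(2)] by auto
  then obtain Mf Mg where Mf: "\<And>x. x \<in> S \<Longrightarrow> norm (f x) \<le> Mf" and Mg: "\<And>x. x \<in> S \<Longrightarrow> norm (g x) \<le> Mg"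
    by (metis bounded_iff imageI)
  have Lf0: "0 \<le> Lf" and Lg0: "0 \<le> Lg" using Lf Lg lipschitz_on_nonneg by blast+
  have "(\<bar>Mf\<bar> * Lg * K + Lf * \<bar>Mg\<bar> * K)-lipschitz_on S (\<lambda>x. b (f x) (g x))"
  proof (rule lipschitz_onI)
    fix x y assume xy: "x \<in> S" "y \<in> S"
    have "b (f x) (g x) - b (f y) (g y) = b (f x) (g x - g y) + b (f x - f y) (g y)"
      by (simp add: diff_left diff_right)
    then have "norm (b (f x) (g x) - b (f y) (g y))
        \<le> norm (f x) * norm (g x - g y) * K + norm (f x - f y) * norm (g y) * K"
      using K(2) by (metis add_mono norm_triangle_le)
    also have "\<dots> \<le> \<bar>Mf\<bar> * (Lg * dist x y) * K + (Lf * dist x y) * \<bar>Mg\<bar> * K"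
      using lipschitz_onD[OF Lf xy] lipschitz_onD[OF Lg xy] Mf[OF xy(1)] Mg[OF xy(2)] K(1) Lf0 Lg0
      by (intro add_mono mult_right_mono mult_mono) (auto simp: dist_norm)
    finally show "dist (b (f x) (g x)) (b (f y) (g y)) \<le> (\<bar>Mf\<bar> * Lg * K + Lf * \<bar>Mg\<bar> * K) * dist x y"
      by (simp add: dist_norm algebra_simps)
  qed (use K Lf0 Lg0 in simp)
  then show ?thesis by blast
qed

lemma lipschitz_on_vec_components:
  fixes f :: "'b::metric_space \<Rightarrow> 'a::real_normed_vector^'n"
  assumes "\<And>i. \<exists>L. L-lipschitz_on S (\<lambda>x. f x $ i)"
  shows "\<exists>L. L-lipschitz_on S f"
proof -
  obtain L where L: "\<And>i. (L i)-lipschitz_on S (\<lambda>x. f x $ i)"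
    using assms by metis
  have "(\<Sum>i\<in>UNIV. L i)-lipschitz_on S f"
  proof (rule lipschitz_onI)
    fix x y assume xy: "x \<in> S" "y \<in> S"
    have "dist (f x) (f y) \<le> (\<Sum>i\<in>UNIV. dist (f x $ i) (f y $ i))"
      unfolding dist_vec_def by (rule L2_set_le_sum) simp
    also have "\<dots> \<le> (\<Sum>i\<in>UNIV. L i * dist x y)"
      by (intro sum_mono lipschitz_onD[OF L] xy)
    finally show "dist (f x) (f y) \<le> (\<Sum>i\<in>UNIV. L i) * dist x y"
      by (simp add: sum_distrib_right)
  qed (auto intro!: sum_nonneg lipschitz_on_nonneg[OF L])
  then show ?thesis by blast
qed

lemma lipschitz_on_row: "\<exists>L. L-lipschitz_on S (\<lambda>A::real^3^3. A $ i)"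
  by (intro exI[of _ 1] lipschitz_onI) (simp_all add: dist_vec_nth_le)

lemma bounded_bilinear_cross3: "bounded_bilinear cross3"
  using bilinear_cross bilinear_conv_bounded_bilinear by blast

lemma lipschitz_on_cof:
  assumes "bounded S" shows "\<exists>L. L-lipschitz_on S cof"
proof (rule lipschitz_on_vec_components)
  show "\<exists>L. L-lipschitz_on S (\<lambda>A. cof A $ i)" for i
    by (rule three_cases[of "\<lambda>i. \<exists>L. L-lipschitz_on S (\<lambda>x. cof x $ i)"]; simp only: cof_rows;
        intro lipschitz_on_bounded_bilinear[OF bounded_bilinear_cross3 assms] lipschitz_on_row)
qed

lemma lipschitz_on_det:
  assumes "bounded S" shows "\<exists>L. L-lipschitz_on S (det :: real^3^3 \<Rightarrow> real)"
  unfolding det_row_cross[abs_def]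
  by (intro lipschitz_on_bounded_bilinear[OF bounded_bilinear_inner assms]
      lipschitz_on_bounded_bilinear[OF bounded_bilinear_cross3 assms] lipschitz_on_row)

lemma lipschitz_on_powr:
  assumes "\<delta> > 0" shows "\<exists>L. L-lipschitz_on {\<delta>..M} (\<lambda>x::real. x powr p)"
proof -
  have "continuous_on {\<delta>..M} (\<lambda>x::real. p * x powr (p - 1))"
    using assms by (intro continuous_intros) auto
  then have "bounded ((\<lambda>x::real. p * x powr (p - 1)) ` {\<delta>..M})"
    by (intro compact_imp_bounded compact_continuous_image compact_Icc)
  then obtain B where B: "\<forall>y\<in>(\<lambda>x::real. p * x powr (p - 1)) ` {\<delta>..M}. norm y \<le> B"
    by (meson bounded_iff)
  have "\<bar>B\<bar>-lipschitz_on {\<delta>..M} (\<lambda>x::real. x powr p)"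
  proof (rule lipschitz_onI)
    fix x y assume xy: "x \<in> {\<delta>..M}" "y \<in> {\<delta>..M}"
    have "norm (x powr p - y powr p) \<le> \<bar>B\<bar> * norm (x - y)"
    proof (rule field_differentiable_bound[OF _ _ _ xy])
      fix z assume z: "z \<in> {\<delta>..M}"
      then show "((\<lambda>z. z powr p) has_field_derivative p * z powr (p - 1)) (at z within {\<delta>..M})"
        using assms by (auto intro!: derivative_eq_intros)
      show "norm (p * z powr (p - 1)) \<le> \<bar>B\<bar>"
        using B z by (meson abs_ge_self imageI order_trans)
    qed simp
    then show "dist (x powr p) (y powr p) \<le> \<bar>B\<bar> * dist x y"
      by (simp add: dist_norm)
  qed simp
  then show ?thesis by blast
qed

text \<open>A globally Lipschitz field that agrees with the force where \<open>norm A \<le> R\<close> and \<open>det A \<ge> \<delta>\<close>. The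
projection to the ball removes the growth at infinity, the cut-off of the determinant removes the
singularity.\<close>
definition truncated_force :: "real \<Rightarrow> real \<Rightarrow> real \<Rightarrow> real^3^3 \<Rightarrow> real^3^3" where
  "truncated_force \<gamma> \<delta> R A =
     (let P = closest_point (cball 0 R) A in max \<delta> (det P) powr (- \<gamma>) *\<^sub>R cof P)"

lemma truncated_force_eq:
  assumes "norm A \<le> R" "det A \<ge> \<delta>"
  shows "truncated_force \<gamma> \<delta> R A = force \<gamma> A"
  using assms by (simp add: truncated_force_def force_def closest_point_self max_def)

lemma truncated_force_lipschitz:
  assumes "\<delta> > 0" "R > 0"
  shows "\<exists>L. L-lipschitz_on UNIV (truncated_force \<gamma> \<delta> R)"
proof -
  let ?B = "cball 0 R :: (real^3^3) set"
  have bd: "bounded ?B" by simp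
  obtain Ld where Ld: "Ld-lipschitz_on ?B (det :: real^3^3 \<Rightarrow> real)"
    using lipschitz_on_det[OF bd] by blast
  have "bounded (det ` ?B)"
    by (intro compact_imp_bounded compact_continuous_image continuous_intros compact_cball)
  then obtain M where M: "\<forall>y\<in>det ` ?B. norm y \<le> M"
    by (meson bounded_iff)
  have m1: "Ld-lipschitz_on ?B (\<lambda>A. max \<delta> (det A))"
  proof (rule lipschitz_onI)
    fix x y assume "x \<in> ?B" "y \<in> ?B"
    then show "dist (max \<delta> (det x)) (max \<delta> (det y)) \<le> Ld * dist x y"
      using lipschitz_onD[OF Ld, of x y] by (auto simp: dist_real_def)
  qed (rule lipschitz_on_nonneg[OF Ld])
  obtain Lp where Lp: "Lp-lipschitz_on {\<delta>..max \<delta> M} (\<lambda>x::real. x powr (- \<gamma>))"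
    using lipschitz_on_powr[OF assms(1)] by blast
  have "Lp-lipschitz_on ((\<lambda>A. max \<delta> (det A)) ` ?B) (\<lambda>x::real. x powr (- \<gamma>))"
  proof (rule lipschitz_on_subset[OF Lp])
    show "(\<lambda>A. max \<delta> (det A)) ` ?B \<subseteq> {\<delta>..max \<delta> M}"
    proof
      fix y assume "y \<in> (\<lambda>A. max \<delta> (det A)) ` ?B"
      then obtain A where "A \<in> ?B" "y = max \<delta> (det A)" by blast
      moreover from this M have "norm (det A) \<le> M" by blast
      ultimately show "y \<in> {\<delta>..max \<delta> M}" by auto
    qed
  qed
  from lipschitz_on_compose2[OF m1 this]
  have "\<exists>L. L-lipschitz_on ?B (\<lambda>A. max \<delta> (det A) powr (- \<gamma>))" by blast
  then obtain L where L: "L-lipschitz_on ?B (\<lambda>A. max \<delta> (det A) powr (- \<gamma>) *\<^sub>R cof A)"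
    using lipschitz_on_bounded_bilinear[OF bounded_bilinear_scaleR bd _ lipschitz_on_cof[OF bd]] by blast
  have P: "1-lipschitz_on UNIV (closest_point ?B)"
    using assms(2) by (intro lipschitz_onI) (auto intro!: closest_point_lipschitz)
  have "closest_point ?B A \<in> ?B" for A
    using assms(2) by (intro closest_point_in_set) auto
  then have "L-lipschitz_on (closest_point ?B ` UNIV) (\<lambda>A. max \<delta> (det A) powr (- \<gamma>) *\<^sub>R cof A)"
    by (intro lipschitz_on_subset[OF L]) blast
  from lipschitz_on_compose2[OF P this] show ?thesis
    unfolding truncated_force_def Let_def by blast
qed

section \<open>Motions: uniqueness and global existence\<close>

text \<open>The derivatives are two-sided, so \<open>S\<close> is meant to be open. The weight is \<open>1\<close> for the original
equation and a power of time for the inverted one. Carrying the velocity as a second function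
avoids nested derivatives.\<close>
definition motion ::
  "(real \<Rightarrow> real) \<Rightarrow> real \<Rightarrow> real set \<Rightarrow> (real \<Rightarrow> real^3^3) \<Rightarrow> (real \<Rightarrow> real^3^3) \<Rightarrow> bool" where
  "motion w \<gamma> S X V \<longleftrightarrow> (\<forall>t\<in>S. X t \<in> GL_plus \<and> (X has_vector_derivative V t) (at t) \<and>
     (V has_vector_derivative w t *\<^sub>R force \<gamma> (X t)) (at t))"

lemma motion_subset: "motion w \<gamma> S X V \<Longrightarrow> S' \<subseteq> S \<Longrightarrow> motion w \<gamma> S' X V"
  unfolding motion_def by blast

lemma motion_continuous:
  assumes "motion w \<gamma> S X V" shows "continuous_on S X" "continuous_on S V"
  using assms unfolding motion_def
  by (meson continuous_at_imp_continuous_on has_vector_derivative_continuous)+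

lemma motion_cong_open:
  assumes "motion w \<gamma> S X V" "open S"
    and "\<And>t. t \<in> S \<Longrightarrow> X' t = X t" "\<And>t. t \<in> S \<Longrightarrow> V' t = V t" "\<And>t. t \<in> S \<Longrightarrow> w' t = w t"
  shows "motion w' \<gamma> S X' V'"
  unfolding motion_def
proof (intro ballI conjI)
  fix t assume t: "t \<in> S"
  show "X' t \<in> GL_plus" using assms t by (simp add: motion_def)
  show "(X' has_vector_derivative V' t) (at t)"
    by (rule has_vector_derivative_transform_within_open[OF _ assms(2) t, of X])
       (use assms t in \<open>auto simp: motion_def\<close>)
  show "(V' has_vector_derivative w' t *\<^sub>R force \<gamma> (X' t)) (at t)"
    by (rule has_vector_derivative_transform_within_open[OF _ assms(2) t, of V])
       (use assms t in \<open>auto simp: motion_def\<close>)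
qed

text \<open>The derivative of the velocity is only required in the interior: this is how a solution is recognised
whose weight is singular at \<open>0\<close>.\<close>
lemma solves_ivpI:
  fixes X V :: "real \<Rightarrow> 'a::euclidean_space"
  assumes V: "continuous_on {0..T} V"
    and dX: "\<And>t. t \<in> {0..T} \<Longrightarrow> (X has_vector_derivative V t) (at t within {0..T})"
    and dV: "\<And>t. t \<in> {0<..<T} \<Longrightarrow> (V has_vector_derivative w t *\<^sub>R G (X t)) (at t)"
  shows "solves_ivp w G T (X 0) (V 0) X V"
  unfolding solves_ivp_def
proof (intro conjI ballI)
  fix t assume t: "t \<in> {0..T}"
  show "((\<lambda>s. w s *\<^sub>R G (X s)) has_integral V t - V 0) {0..t}"
    using t dV by (intro fundamental_theorem_of_calculus_interior continuous_on_subset[OF V]) auto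
qed (use dX in auto)

lemma solves_ivp_velocity_derivative:
  assumes Z: "solves_ivp w G T z0 v0 Z V" and t: "t \<in> {0..T}"
    and cont: "continuous (at t within {0..T}) (\<lambda>s. w s *\<^sub>R G (Z s))"
  shows "(V has_vector_derivative w t *\<^sub>R G (Z t)) (at t within {0..T})"
proof (rule has_vector_derivative_transform[where f = "\<lambda>t. v0 + integral {0..t} (\<lambda>s. w s *\<^sub>R G (Z s))"])
  have int: "((\<lambda>s. w s *\<^sub>R G (Z s)) has_integral (V s - v0)) {0..s}" if "s \<in> {0..T}" for s
    using Z that unfolding solves_ivp_def by auto
  show "V s = v0 + integral {0..s} (\<lambda>s. w s *\<^sub>R G (Z s))" if "s \<in> {0..T}" for s
    using integral_unique[OF int[OF that]] by simp
  have "(\<lambda>s. w s *\<^sub>R G (Z s)) integrable_on {0..T}"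
    using int[of T] t by auto
  from integral_has_vector_derivative_continuous_at[OF this, of t "{}"] t cont
  show "((\<lambda>t. v0 + integral {0..t} (\<lambda>s. w s *\<^sub>R G (Z s))) has_vector_derivative w t *\<^sub>R G (Z t)) (at t within {0..T})"
    by (auto intro!: derivative_eq_intros)
qed (use t in auto)

lemma compact_subset_GL_plus:
  assumes "compact K" "K \<subseteq> GL_plus"
  shows "\<exists>\<delta>>0. \<exists>R>0. \<forall>A\<in>K. \<delta> \<le> det A \<and> norm A \<le> R"
proof (cases "K = {}")
  case False
  have "continuous_on K det"
    by (intro continuous_intros)
  from continuous_attains_inf[OF assms(1) False this]
  obtain A where A: "A \<in> K" "\<And>B. B \<in> K \<Longrightarrow> det A \<le> det B" by blast
  obtain R where "R > 0" "\<And>B. B \<in> K \<Longrightarrow> norm B \<le> R"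
    using compact_imp_bounded[OF assms(1)] by (auto simp: bounded_pos)
  then show ?thesis
    using A assms(2) by (intro exI[of _ "det A"]) (auto simp: GL_plus_def)
qed (auto intro: exI[of _ 1])

text \<open>A compact set of matrices of positive determinant need not be convex, so bounding the derivative of
the force would not suffice; but on such a set the force coincides with a globally Lipschitz
truncation.\<close>
lemma force_lipschitz_on_compact:
  assumes "compact K" "K \<subseteq> GL_plus"
  shows "\<exists>L. L-lipschitz_on K (force \<gamma>)"
proof -
  obtain \<delta> R where *: "\<delta> > 0" "R > 0" "\<And>A. A \<in> K \<Longrightarrow> \<delta> \<le> det A \<and> norm A \<le> R"
    using compact_subset_GL_plus[OF assms] by blast
  obtain L where "L-lipschitz_on UNIV (truncated_force \<gamma> \<delta> R)"
    using truncated_force_lipschitz *(1,2) by blast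
  then have "L-lipschitz_on K (truncated_force \<gamma> \<delta> R)"
    by (rule lipschitz_on_subset) simp
  then show ?thesis
    using *(3) by (intro exI[of _ L]) (auto elim!: lipschitz_on_transform simp: truncated_force_eq)
qed

lemma solves_ivp_force_unique:
  assumes w: "w integrable_on {0..T}" "\<And>s. s \<in> {0..T} \<Longrightarrow> 0 \<le> w s"
    and 1: "solves_ivp w (force \<gamma>) T z0 v0 Z1 V1" "Z1 ` {0..T} \<subseteq> GL_plus"
    and 2: "solves_ivp w (force \<gamma>) T z0 v0 Z2 V2" "Z2 ` {0..T} \<subseteq> GL_plus"
    and t: "t \<in> {0..T}"
  shows "Z1 t = Z2 t \<and> V1 t = V2 t"
proof -
  have "compact (Z1 ` {0..T} \<union> Z2 ` {0..T})"
    by (intro compact_Un compact_continuous_image solves_ivp_continuous[OF 1(1)]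
        solves_ivp_continuous[OF 2(1)] compact_Icc)
  then obtain L where "L-lipschitz_on (Z1 ` {0..T} \<union> Z2 ` {0..T}) (force \<gamma>)"
    using force_lipschitz_on_compact 1(2) 2(2) by (meson Un_least)
  from solves_ivp_unique[OF this w 1(1) _ 2(1) _ t] show ?thesis by simp
qed

text \<open>With \<open>e = 1\<close> a translation of time, with \<open>e = -1\<close> a reflection: the equation is autonomous and of
second order.\<close>
lemma motion_affine_time:
  assumes "motion (\<lambda>_. 1) \<gamma> S X V" and e: "e * e = 1"
  shows "motion (\<lambda>_. 1) \<gamma> {t. c + e * t \<in> S} (\<lambda>t. X (c + e * t)) (\<lambda>t. e *\<^sub>R V (c + e * t))"
  unfolding motion_def
proof (intro ballI conjI)
  fix t assume t: "t \<in> {t. c + e * t \<in> S}"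
  have m: "X (c + e * t) \<in> GL_plus" "(X has_vector_derivative V (c + e * t)) (at (c + e * t))"
    "(V has_vector_derivative force \<gamma> (X (c + e * t))) (at (c + e * t))"
    using assms(1) t unfolding motion_def by auto
  show "X (c + e * t) \<in> GL_plus" by fact
  have l: "((\<lambda>t. c + e * t) has_vector_derivative e) (at t)"
    by (auto intro!: derivative_eq_intros simp flip: has_real_derivative_iff_has_vector_derivative)
  show "((\<lambda>t. X (c + e * t)) has_vector_derivative e *\<^sub>R V (c + e * t)) (at t)"
    using vector_diff_chain_at[OF l m(2)] by (simp add: o_def)
  have "((\<lambda>t. V (c + e * t)) has_vector_derivative e *\<^sub>R force \<gamma> (X (c + e * t))) (at t)"
    using vector_diff_chain_at[OF l m(3)] by (simp add: o_def)
  from has_vector_derivative_scaleR[OF DERIV_const[of e] this]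
  show "((\<lambda>t. e *\<^sub>R V (c + e * t)) has_vector_derivative 1 *\<^sub>R force \<gamma> (X (c + e * t))) (at t)"
    using e by simp
qed

lemma motion_imp_solves_ivp:
  assumes "motion w \<gamma> S X V" "{0..T} \<subseteq> S"
  shows "solves_ivp w (force \<gamma>) T (X 0) (V 0) X V" "X ` {0..T} \<subseteq> GL_plus"
proof -
  have "(X has_vector_derivative V t) (at t within {0..T})"
    "(V has_vector_derivative w t *\<^sub>R force \<gamma> (X t)) (at t)" "X t \<in> GL_plus" if "t \<in> {0..T}" for t
    using assms that unfolding motion_def by (blast intro: has_vector_derivative_at_within)+
  then show "solves_ivp w (force \<gamma>) T (X 0) (V 0) X V" "X ` {0..T} \<subseteq> GL_plus"
    using continuous_on_subset[OF motion_continuous(2)[OF assms(1)] assms(2)]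
    by (auto intro!: solves_ivpI)
qed

text \<open>Translating \<open>a\<close> to \<open>0\<close>, and reflecting time if \<open>b < a\<close>, reduces this to the uniqueness of an initial
value problem on a compact interval.\<close>
proposition motion_unique:
  assumes 1: "motion (\<lambda>_. 1) \<gamma> S X V" and 2: "motion (\<lambda>_. 1) \<gamma> S X' V'"
    and init: "X a = X' a" "V a = V' a" and sub: "closed_segment a b \<subseteq> S"
  shows "X b = X' b \<and> V b = V' b"
proof -
  define e :: real where "e = (if a \<le> b then 1 else - 1)"
  define T where "T = \<bar>b - a\<bar>"
  have e: "e * e = 1" "a + e * T = b" and T: "0 \<le> T" unfolding e_def T_def by auto
  have S: "{0..T} \<subseteq> {t. a + e * t \<in> S}"
  proof
    fix t assume "t \<in> {0..T}"
    then have "a + e * t \<in> closed_segment a b"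
      unfolding e_def T_def by (auto simp: closed_segment_eq_real_ivl split: if_splits)
    then show "t \<in> {t. a + e * t \<in> S}" using sub by auto
  qed
  note m1 = motion_imp_solves_ivp[OF motion_affine_time[OF 1 e(1)] S]
    and m2 = motion_imp_solves_ivp[OF motion_affine_time[OF 2 e(1)] S]
  have "solves_ivp (\<lambda>_. 1) (force \<gamma>) T (X (a + e * 0)) (e *\<^sub>R V (a + e * 0))
     (\<lambda>t. X' (a + e * t)) (\<lambda>t. e *\<^sub>R V' (a + e * t))"
    using m2(1) init by simp
  from solves_ivp_force_unique[OF _ _ m1 this m2(2), of T] T e
  have "X b = X' b \<and> e *\<^sub>R V b = e *\<^sub>R V' b" by auto
  then show ?thesis unfolding e_def by (auto split: if_splits)
qed

lemma potential_pos: "A \<in> GL_plus \<Longrightarrow> \<gamma> > 1 \<Longrightarrow> potential \<gamma> A > 0"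
  by (simp add: potential_def GL_plus_def)

text \<open>The potential blows up as the determinant tends to zero; this is the barrier that keeps a motion of
bounded energy inside the domain.\<close>
lemma det_ge_of_potential_le:
  assumes "A \<in> GL_plus" "\<gamma> > 1" "potential \<gamma> A \<le> e"
  shows "((\<gamma> - 1) * e) powr (1 / (1 - \<gamma>)) \<le> det A"
proof -
  have d: "det A > 0" using assms by (simp add: GL_plus_def)
  have "det A powr (1 - \<gamma>) \<le> (\<gamma> - 1) * e"
    using assms(2,3) by (simp add: potential_def field_simps)
  then have "((\<gamma> - 1) * e) powr (1 / (1 - \<gamma>)) \<le> (det A powr (1 - \<gamma>)) powr (1 / (1 - \<gamma>))"
    using assms(2) d by (intro powr_mono2') auto
  also have "\<dots> = det A"
    using assms(2) d by (simp add: powr_powr)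
  finally show ?thesis .
qed

lemma norm_le_sqrt_of_kinetic:
  fixes v :: "'a::real_inner"
  assumes "(v \<bullet> v) / 2 \<le> e" shows "norm v \<le> sqrt (2 * e)"
  using assms by (simp add: norm_eq_sqrt_inner)

text \<open>The truncated problem has a solution on all of \<open>[0, T]\<close>. As long as the truncation is
not felt, energy is conserved, which gives \<open>det Z \<ge> \<delta>0\<close> and a bound on the speed; both are strictly
better than the thresholds of the truncation, so these are never reached.\<close>
proposition solves_ivp_force_exists:
  assumes \<gamma>: "\<gamma> > 1" and x0: "x0 \<in> GL_plus" and T: "0 \<le> T"
  shows "\<exists>Z V. solves_ivp (\<lambda>_. 1) (force \<gamma>) T x0 v0 Z V \<and> Z ` {0..T} \<subseteq> GL_plus"
proof -
  define E where "E = (v0 \<bullet> v0) / 2 + potential \<gamma> x0"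
  define \<delta>0 where "\<delta>0 = ((\<gamma> - 1) * E) powr (1 / (1 - \<gamma>))"
  define \<delta> where "\<delta> = \<delta>0 / 2"
  define R where "R = norm x0 + sqrt (2 * E) * T + 1"
  have E: "E > 0" unfolding E_def using potential_pos[OF x0 \<gamma>] by (simp add: add_nonneg_pos)
  have \<delta>0: "\<delta>0 > 0" unfolding \<delta>0_def using \<gamma> E by simp
  then have \<delta>: "0 < \<delta>" "\<delta> < \<delta>0" unfolding \<delta>_def by auto
  have R: "R > 0" "norm x0 + sqrt (2 * E) * T < R"
    unfolding R_def using E T by (auto intro: add_nonneg_pos)
  obtain L where L: "L-lipschitz_on UNIV (truncated_force \<gamma> \<delta> R)"
    using truncated_force_lipschitz[OF \<delta>(1) R(1)] by blast
  have "\<exists>Z V. solves_ivp (\<lambda>_. 1) (truncated_force \<gamma> \<delta> R) T x0 v0 Z V"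
    by (rule solves_ivp_exists[OF L integrable_const_ivl _ T]) simp
  then obtain Z V where ZV: "solves_ivp (\<lambda>_. 1) (truncated_force \<gamma> \<delta> R) T x0 v0 Z V" by blast
  note contZ = solves_ivp_continuous(1)[OF ZV] and contV = solves_ivp_continuous(2)[OF ZV]
  have Z0: "Z 0 = x0" and V0: "V 0 = v0"
    using ZV solves_ivp_initial_velocity[OF ZV T] by (auto simp: solves_ivp_def)
  have dZ: "(Z has_vector_derivative V t) (at t within {0..T})" if "t \<in> {0..T}" for t
    using ZV that by (auto simp: solves_ivp_def)
  have dV: "(V has_vector_derivative truncated_force \<gamma> \<delta> R (Z t)) (at t within {0..T})" if "t \<in> {0..T}" for t
  proof -
    have "continuous_on {0..T} (\<lambda>t. 1 *\<^sub>R truncated_force \<gamma> \<delta> R (Z t))"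
      unfolding scaleR_one by (rule continuous_on_compose2[OF lipschitz_on_continuous_on[OF L] contZ]) simp
    then show ?thesis
      using solves_ivp_velocity_derivative[OF ZV that] that
      by (simp add: continuous_on_eq_continuous_within)
  qed
  \<comment> \<open>The times at which a threshold is reached; the first of them leads to a contradiction.\<close>
  define bad where "bad = {0..T} \<inter> Z -` ({A. det A \<le> \<delta>} \<union> {A. R \<le> norm A})"
  have "bad = {}"
  proof (rule ccontr)
    assume "bad \<noteq> {}"
    have "closed ({A :: real^3^3. det A \<le> \<delta>} \<union> {A. R \<le> norm A})"
      by (intro closed_Un closed_Collect_le continuous_intros)
    then have "closed bad"
      unfolding bad_def by (intro continuous_closed_preimage contZ closed_atLeastAtMost)
    then have "compact bad"
      unfolding bad_def by (metis Int_lower1 compact_Icc closed_Int_compact inf.absorb_iff1 inf_commute)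
    then obtain x where x: "x \<in> bad" and least: "\<And>t. t \<in> bad \<Longrightarrow> x \<le> t"
      using compact_attains_inf[OF _ \<open>bad \<noteq> {}\<close>] by blast
    have xT: "x \<in> {0..T}" using x unfolding bad_def by auto
    have good: "\<delta> < det (Z t) \<and> norm (Z t) < R" if "t \<in> {0..<x}" for t
      using least[of t] that xT unfolding bad_def by force
    have det0: "\<delta>0 \<le> det x0"
      unfolding \<delta>0_def by (rule det_ge_of_potential_le[OF x0 \<gamma>]) (simp add: E_def)
    have "sqrt (2 * E) * T \<ge> 0" using E T by simp
    then have "x \<noteq> 0"
      using x det0 \<delta> R(2) Z0 unfolding bad_def by auto
    then have x0': "0 < x" using xT by auto
    then have cl: "closure {0..<x} = {0..x}" by simp
    have sub: "{0..x} \<subseteq> {0..T}" using xT by auto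
    \<comment> \<open>At the first bad time the inequalities hold weakly, by continuity, and this is enough for the
        truncated field to equal the force there.\<close>
    have good': "\<delta> \<le> det (Z t) \<and> norm (Z t) \<le> R" if "t \<in> {0..x}" for t
    proof
      have c: "continuous_on (closure {0..<x}) (\<lambda>t. det (Z t))" "continuous_on (closure {0..<x}) (\<lambda>t. norm (Z t))"
        unfolding cl by (intro continuous_intros continuous_on_subset[OF contZ sub])+
      show "\<delta> \<le> det (Z t)"
        by (rule continuous_ge_on_closure[OF c(1)]) (use cl that good in \<open>auto intro: less_imp_le\<close>)
      show "norm (Z t) \<le> R"
        by (rule continuous_le_on_closure[OF c(2)]) (use cl that good in \<open>auto intro: less_imp_le\<close>)
    qed
    have GL: "Z t \<in> GL_plus" if "t \<in> {0..x}" for t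
      using good'[OF that] \<delta> by (simp add: GL_plus_def)
    have "((\<lambda>t. (V t \<bullet> V t) / 2 + 1 * potential \<gamma> (Z t)) has_real_derivative 0 * potential \<gamma> (Z t)) (at t within {0..x})"
      if t: "t \<in> {0..x}" for t
    proof (rule energy_has_derivative)
      show "(Z has_vector_derivative V t) (at t within {0..x})"
        by (rule has_vector_derivative_within_subset[OF dZ sub]) (use t sub in auto)
      have "(V has_vector_derivative truncated_force \<gamma> \<delta> R (Z t)) (at t within {0..x})"
        by (rule has_vector_derivative_within_subset[OF dV sub]) (use t sub in auto)
      then show "(V has_vector_derivative 1 *\<^sub>R force \<gamma> (Z t)) (at t within {0..x})"
        using good'[OF t] by (simp add: truncated_force_eq)
    qed (use GL t \<gamma> in auto)
    then have "\<exists>c. \<forall>t\<in>{0..x}. (V t \<bullet> V t) / 2 + potential \<gamma> (Z t) = c"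
      by (intro has_field_derivative_zero_constant) auto
    then obtain c where c: "\<forall>t\<in>{0..x}. (V t \<bullet> V t) / 2 + potential \<gamma> (Z t) = c" ..
    have en: "(V t \<bullet> V t) / 2 + potential \<gamma> (Z t) = E" if "t \<in> {0..x}" for t
      using c[rule_format, OF that] c[rule_format, of 0] x0' Z0 V0 by (simp add: E_def)
    have Vb: "norm (V t) \<le> sqrt (2 * E)" if "t \<in> {0..x}" for t
      by (rule norm_le_sqrt_of_kinetic) (use en[OF that] potential_pos[OF GL[OF that] \<gamma>] in linarith)
    have "(V has_integral Z x - Z 0) {0..x}"
      using x0' sub by (intro fundamental_theorem_of_calculus has_vector_derivative_within_subset[OF dZ sub]) auto
    then have "norm (Z x - x0) \<le> sqrt (2 * E) * measure lborel {0..x}"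
      unfolding Z0 by (intro has_integral_bound_real[of _ "{}" V]) (use Vb E in auto)
    also have "\<dots> \<le> sqrt (2 * E) * T"
      using x0' xT E by (intro mult_left_mono) auto
    finally have "norm (Z x) < R"
      using R(2) norm_triangle_sub[of "Z x" x0] by linarith
    moreover have "\<delta>0 \<le> det (Z x)"
      unfolding \<delta>0_def
      by (rule det_ge_of_potential_le[OF GL \<gamma>]) (use en[of x] x0' in auto)
    ultimately show False
      using x \<delta> unfolding bad_def by auto
  qed
  then have g: "\<delta> < det (Z t) \<and> norm (Z t) < R" if "t \<in> {0..T}" for t
    using that unfolding bad_def by force
  have "solves_ivp (\<lambda>_. 1) (force \<gamma>) T x0 v0 Z V"
    by (rule solves_ivp_cong[OF ZV]) (use g in \<open>auto simp: truncated_force_eq less_imp_le\<close>)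
  moreover have "Z ` {0..T} \<subseteq> GL_plus"
    using g \<delta> by (force simp: GL_plus_def)
  ultimately show ?thesis by blast
qed

text \<open>Away from \<open>0\<close> and \<open>T\<close>, the integrated equation for the velocity can be differentiated.\<close>
lemma solves_ivp_force_imp_motion:
  assumes Z: "solves_ivp w (force \<gamma>) T x0 v0 Z V" "Z ` {0..T} \<subseteq> GL_plus"
    and w: "continuous_on {0<..<T} w"
  shows "motion w \<gamma> {0<..<T} Z V"
  unfolding motion_def
proof (intro ballI conjI)
  fix t assume t: "t \<in> {0<..<T}"
  have at: "at t within {0..T} = at t"
    using t by (intro at_within_interior) (auto simp: interior_atLeastAtMost_real)
  show "Z t \<in> GL_plus" using Z(2) t by auto
  show "(Z has_vector_derivative V t) (at t)"
    using Z(1) t at unfolding solves_ivp_def by (metis atLeastAtMost_iff greaterThanLessThan_iff less_imp_le)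
  have sub: "{0<..<T} \<subseteq> {0..T}" by auto
  have "continuous_on {0<..<T} (\<lambda>s. w s *\<^sub>R force \<gamma> (Z s))"
    by (intro continuous_intros w continuous_on_force continuous_on_subset[OF solves_ivp_continuous(1)[OF Z(1)] sub])
       (use Z(2) sub in blast)
  then have "continuous (at t) (\<lambda>s. w s *\<^sub>R force \<gamma> (Z s))"
    using t continuous_on_eq_continuous_at open_greaterThanLessThan by blast
  then show "(V has_vector_derivative w t *\<^sub>R force \<gamma> (Z t)) (at t)"
    using solves_ivp_velocity_derivative[OF Z(1), of t] t at by auto
qed

lemma solves_ivp_force_reverse:
  assumes Z: "solves_ivp (\<lambda>_. 1) (force \<gamma>) T x0 v0 Z V" "Z ` {0..T} \<subseteq> GL_plus"
  shows "solves_ivp (\<lambda>_. 1) (force \<gamma>) T (Z T) (- V T) (\<lambda>s. Z (T - s)) (\<lambda>s. - V (T - s))"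
proof -
  have l: "((\<lambda>t. T - t) has_vector_derivative - 1) (at t within S)" for t S
    by (auto intro!: derivative_eq_intros simp flip: has_real_derivative_iff_has_vector_derivative)
  have im: "(\<lambda>t. T - t) ` {0..T} = {0..T}"
    by (auto intro!: image_eqI[of _ _ "T - _"])
  have "continuous_on {0..T} (\<lambda>s. - V (T - s))"
    by (intro continuous_intros continuous_on_compose2[OF solves_ivp_continuous(2)[OF Z(1)]]) auto
  moreover have "((\<lambda>s. Z (T - s)) has_vector_derivative - V (T - t)) (at t within {0..T})" if "t \<in> {0..T}" for t
  proof -
    have "(Z has_vector_derivative V (T - t)) (at (T - t) within (\<lambda>t. T - t) ` {0..T})"
      using Z(1) that unfolding im solves_ivp_def by auto
    from vector_diff_chain_within[OF l this] show ?thesis by (simp add: o_def)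
  qed
  moreover have "((\<lambda>s. - V (T - s)) has_vector_derivative 1 *\<^sub>R force \<gamma> (Z (T - t))) (at t)" if "t \<in> {0<..<T}" for t
    using motion_affine_time[OF solves_ivp_force_imp_motion[OF Z continuous_on_const], of "-1" T] that
    unfolding motion_def by auto
  ultimately show ?thesis
    using solves_ivpI[of T "\<lambda>s. - V (T - s)" "\<lambda>s. Z (T - s)" "\<lambda>_. 1" "force \<gamma>"] by simp
qed

text \<open>Solutions are constructed forwards in time only. Running time \<open>T\<close> backwards from the given data and
then time \<open>2 T\<close> forwards passes, by uniqueness, through the given data again; this
gives a two-sided solution without gluing two pieces at the initial time.\<close>
lemma motion_exists_symmetric:
  assumes \<gamma>: "\<gamma> > 1" and x0: "x0 \<in> GL_plus" and T: "T > 0"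
  shows "\<exists>X V. motion (\<lambda>_. 1) \<gamma> {-T<..<T} X V \<and> X 0 = x0 \<and> V 0 = v0"
proof -
  obtain Z V where Z: "solves_ivp (\<lambda>_. 1) (force \<gamma>) T x0 (- v0) Z V" "Z ` {0..T} \<subseteq> GL_plus"
    using solves_ivp_force_exists[OF \<gamma> x0, of T "- v0"] T by auto
  have ZT: "Z T \<in> GL_plus" using Z(2) T by auto
  obtain Y W where Y: "solves_ivp (\<lambda>_. 1) (force \<gamma>) (2 * T) (Z T) (- V T) Y W" "Y ` {0..2 * T} \<subseteq> GL_plus"
    using solves_ivp_force_exists[OF \<gamma> ZT, of "2 * T" "- V T"] T by auto
  have "Y T = Z (T - T) \<and> W T = - V (T - T)"
  proof (rule solves_ivp_force_unique[where w = "\<lambda>_. 1" and ?Z1.0 = Y and ?V1.0 = W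
        and ?Z2.0 = "\<lambda>s. Z (T - s)" and ?V2.0 = "\<lambda>s. - V (T - s)"])
    show "solves_ivp (\<lambda>_. 1) (force \<gamma>) T (Z T) (- V T) Y W"
      by (rule solves_ivp_subinterval[OF Y(1)]) (use T in simp)
    show "Y ` {0..T} \<subseteq> GL_plus"
      using Y(2) T by (auto simp: image_subset_iff)
    show "(\<lambda>s. Z (T - s)) ` {0..T} \<subseteq> GL_plus"
      using Z(2) by (auto simp: image_subset_iff)
  qed (use solves_ivp_force_reverse[OF Z] T in auto)
  moreover have "Z 0 = x0" "V 0 = - v0"
    using Z(1) solves_ivp_initial_velocity[OF Z(1)] T by (auto simp: solves_ivp_def)
  ultimately have init: "Y (T + 1 * 0) = x0" "1 *\<^sub>R W (T + 1 * 0) = v0" by simp_all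
  have "motion (\<lambda>_. 1) \<gamma> {-T<..<T} (\<lambda>t. Y (T + 1 * t)) (\<lambda>t. 1 *\<^sub>R W (T + 1 * t))"
    by (rule motion_subset[OF motion_affine_time[OF solves_ivp_force_imp_motion[OF Y continuous_on_const]]]) auto
  with init show ?thesis by blast
qed

text \<open>Solutions on the intervals \<open>(-n-1, n+1)\<close> agree on their overlaps, and each time \<open>t\<close> lies in the
interval of index \<open>k t\<close>.\<close>
proposition motion_exists:
  assumes \<gamma>: "\<gamma> > 1" and x0: "x0 \<in> GL_plus"
  shows "\<exists>X V. motion (\<lambda>_. 1) \<gamma> UNIV X V \<and> X a = x0 \<and> V a = v0"
proof -
  have "\<exists>X V. motion (\<lambda>_. 1) \<gamma> {-real (Suc n)<..<real (Suc n)} X V \<and> X 0 = x0 \<and> V 0 = v0" for n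
    by (rule motion_exists_symmetric[OF \<gamma> x0]) simp
  then obtain X V where XV: "\<And>n. motion (\<lambda>_. 1) \<gamma> {-real (Suc n)<..<real (Suc n)} (X n) (V n)"
    and init: "\<And>n. X n 0 = x0" "\<And>n. V n 0 = v0"
    by metis
  define k where "k t = nat \<lceil>\<bar>t\<bar>\<rceil>" for t :: real
  have k: "\<bar>t\<bar> < real (Suc (k t))" for t unfolding k_def by linarith
  have agree: "X m t = X n t \<and> V m t = V n t" if "\<bar>t\<bar> < real (Suc m)" "\<bar>t\<bar> < real (Suc n)" for m n t
  proof (rule motion_unique[where a = 0])
    let ?S = "{-real (Suc m)<..<real (Suc m)} \<inter> {-real (Suc n)<..<real (Suc n)}"
    show "motion (\<lambda>_. 1) \<gamma> ?S (X m) (V m)" "motion (\<lambda>_. 1) \<gamma> ?S (X n) (V n)"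
      by (rule motion_subset[OF XV], blast)+
    show "closed_segment 0 t \<subseteq> ?S"
      using that by (auto simp: closed_segment_eq_real_ivl split: if_splits)
  qed (use init in auto)
  define Y W where "Y t = X (k t) t" and "W t = V (k t) t" for t
  have "motion (\<lambda>_. 1) \<gamma> {-real (Suc n)<..<real (Suc n)} Y W" for n
    by (rule motion_cong_open[OF XV]) (use agree k in \<open>auto simp: Y_def W_def\<close>)
  then have "motion (\<lambda>_. 1) \<gamma> UNIV Y W"
    unfolding motion_def using k by (metis abs_less_iff greaterThanLessThan_iff minus_less_iff)
  from motion_affine_time[OF this, of 1 "- a"]
  have "motion (\<lambda>_. 1) \<gamma> UNIV (\<lambda>t. Y (- a + 1 * t)) (\<lambda>t. 1 *\<^sub>R W (- a + 1 * t))" by simp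
  moreover have "Y (- a + 1 * a) = x0" "1 *\<^sub>R W (- a + 1 * a) = v0"
    using init by (simp_all add: Y_def W_def)
  ultimately show ?thesis by blast
qed

section \<open>Smoothness of motions\<close>

lemma has_vector_derivative_matrixI:
  fixes Y :: "real \<Rightarrow> real^'n^'m"
  assumes "\<And>i j. ((\<lambda>t. Y t $ i $ j) has_real_derivative D $ i $ j) (at t within S)"
  shows "(Y has_vector_derivative D) (at t within S)"
  unfolding has_vector_derivative_def
proof (subst has_derivative_componentwise_within, intro ballI)
  fix b :: "real^'n^'m" assume "b \<in> Basis"
  then obtain i j where b: "b = axis i (axis j 1)"
    by (auto simp: Basis_vec_def)
  show "((\<lambda>x. Y x \<bullet> b) has_derivative (\<lambda>x. (x *\<^sub>R D) \<bullet> b)) (at t within S)"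
    using assms[of i j]
    unfolding b has_real_derivative_iff_has_vector_derivative has_vector_derivative_def
    by (simp add: inner_axis)
qed

text \<open>Polynomial expressions in the entries of the position and of the velocity and in real powers of the
determinant. The equation of motion makes this class closed under differentiation, so
one induction yields all derivatives at once.\<close>
inductive jet :: "(real \<Rightarrow> real^3^3) \<Rightarrow> (real \<Rightarrow> real^3^3) \<Rightarrow> (real \<Rightarrow> real) \<Rightarrow> bool" for X V where
  const: "jet X V (\<lambda>t. c)"
| position: "jet X V (\<lambda>t. X t $ i $ j)"
| velocity: "jet X V (\<lambda>t. V t $ i $ j)"
| det_powr: "jet X V (\<lambda>t. det (X t) powr p)"
| add: "jet X V f \<Longrightarrow> jet X V g \<Longrightarrow> jet X V (\<lambda>t. f t + g t)"
| mult: "jet X V f \<Longrightarrow> jet X V g \<Longrightarrow> jet X V (\<lambda>t. f t * g t)"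

lemma jet_diff: "jet X V f \<Longrightarrow> jet X V g \<Longrightarrow> jet X V (\<lambda>t. f t - g t)"
  using jet.add[of X V f, OF _ jet.mult[OF jet.const[of X V "-1"], of g]] by simp

lemma jet_cof: "jet X V (\<lambda>t. cof (X t) $ i $ j)"
proof -
  have "jet X V (\<lambda>t. cross3 (X t $ a) (X t $ b) $ j)" for a b
    by (rule three_cases[of "\<lambda>j. jet X V (\<lambda>t. cross3 (X t $ a) (X t $ b) $ j)"])
       (simp_all add: cross3_def jet_diff jet.mult jet.position)
  then show ?thesis
    by - (rule three_cases[of "\<lambda>i. jet X V (\<lambda>t. cof (X t) $ i $ j)"], simp_all add: cof_rows)
qed

lemma jet_has_derivative:
  assumes m: "motion (\<lambda>_. 1) \<gamma> UNIV X V" and "jet X V f"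
  shows "\<exists>f'. jet X V f' \<and> (\<forall>t. (f has_real_derivative f' t) (at t))"
  using assms(2)
proof induction
  case (const c)
  then show ?case by (intro exI[of _ "\<lambda>t. 0"]) (simp add: jet.const)
next
  case (position i j)
  show ?case
    using m unfolding motion_def
    by (intro exI[of _ "\<lambda>t. V t $ i $ j"]) (auto intro: jet.velocity has_vector_derivative_matrix_entry)
next
  case (velocity i j)
  have "jet X V (\<lambda>t. force \<gamma> (X t) $ i $ j)"
    unfolding force_def by (simp add: jet.mult jet.det_powr jet_cof)
  moreover have "((\<lambda>t. V t $ i $ j) has_real_derivative force \<gamma> (X t) $ i $ j) (at t)" for t
    using m unfolding motion_def by (auto intro: has_vector_derivative_matrix_entry)
  ultimately show ?case by blast
next
  case (det_powr p)
  have "jet X V (\<lambda>t. cof (X t) \<bullet> V t)"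
    unfolding inner_vec_def sum_3 by (intro jet.add) (simp_all add: jet.mult jet_cof jet.velocity)
  then have "jet X V (\<lambda>t. p * det (X t) powr (p - 1) * (cof (X t) \<bullet> V t))"
    by (intro jet.mult jet.const jet.det_powr)
  moreover have "((\<lambda>t. det (X t) powr p) has_real_derivative p * det (X t) powr (p - 1) * (cof (X t) \<bullet> V t)) (at t)" for t
  proof -
    have "det (X t) > 0" and d: "(X has_vector_derivative V t) (at t)"
      using m unfolding motion_def GL_plus_def by auto
    then show ?thesis
      by (auto intro!: derivative_eq_intros det_has_derivative[OF d])
  qed
  ultimately show ?case by blast
next
  case (add f g)
  then obtain f' g' where "jet X V f'" "\<forall>t. (f has_real_derivative f' t) (at t)"
    "jet X V g'" "\<forall>t. (g has_real_derivative g' t) (at t)" by blast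
  then show ?case
    by (intro exI[of _ "\<lambda>t. f' t + g' t"]) (auto intro: jet.add DERIV_add)
next
  case (mult f g)
  then obtain f' g' where fg: "jet X V f'" "\<forall>t. (f has_real_derivative f' t) (at t)"
    "jet X V g'" "\<forall>t. (g has_real_derivative g' t) (at t)" by blast
  then have "jet X V (\<lambda>t. f' t * g t + g' t * f t)"
    using mult by (intro jet.add jet.mult)
  then show ?case
    using fg by (intro exI[of _ "\<lambda>t. f' t * g t + g' t * f t"]) (auto intro: DERIV_mult)
qed

lemma jet_matrix_has_derivative:
  fixes Y :: "real \<Rightarrow> real^3^3"
  assumes m: "motion (\<lambda>_. 1) \<gamma> UNIV X V" and Y: "\<And>i j. jet X V (\<lambda>t. Y t $ i $ j)"
  shows "\<exists>Y'. (\<forall>i j. jet X V (\<lambda>t. Y' t $ i $ j)) \<and> (\<forall>t. (Y has_vector_derivative Y' t) (at t))"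
proof -
  have "\<forall>i. \<exists>f. \<forall>j. jet X V (f j) \<and> (\<forall>t. ((\<lambda>t. Y t $ i $ j) has_real_derivative f j t) (at t))"
    by (intro allI choice jet_has_derivative[OF m Y])
  from choice[OF this] obtain f
    where f: "\<And>i j. jet X V (f i j)" "\<And>i j t. ((\<lambda>t. Y t $ i $ j) has_real_derivative f i j t) (at t)"
    by blast
  show ?thesis
    using f by (intro exI[of _ "\<lambda>t. \<chi> i j. f i j t"]) (auto intro!: has_vector_derivative_matrixI)
qed

proposition motion_imp_global_solution:
  assumes m: "motion (\<lambda>_. 1) \<gamma> UNIV X V"
  shows "is_global_solution \<gamma> X" and "time_deriv X = V"
proof -
  have d: "X t \<in> GL_plus" "(X has_vector_derivative V t) (at t)"
    "(V has_vector_derivative force \<gamma> (X t)) (at t)" for t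
    using m unfolding motion_def by auto
  show V: "time_deriv X = V"
    unfolding time_deriv_def using d by (auto intro: vector_derivative_at)
  have jets: "\<forall>i j. jet X V (\<lambda>t. (time_deriv ^^ n) X t $ i $ j)" for n
  proof (induction n)
    case (Suc n)
    then obtain Y' where Y': "\<forall>i j. jet X V (\<lambda>t. Y' t $ i $ j)"
      "\<forall>t. ((time_deriv ^^ n) X has_vector_derivative Y' t) (at t)"
      using jet_matrix_has_derivative[OF m] by blast
    then have "(time_deriv ^^ Suc n) X = Y'"
      unfolding funpow.simps o_apply time_deriv_def[of "(time_deriv ^^ n) X"]
      by (intro ext vector_derivative_at) blast
    with Y' show ?case by simp
  qed (simp add: jet.position)
  have "C_infinity X"
    unfolding C_infinity_def
    using jet_matrix_has_derivative[OF m] jets by (meson differentiableI_vector)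
  moreover have "time_deriv V t = det (X t) powr (1 - \<gamma>) *\<^sub>R transpose (matrix_inv (X t))" for t
    unfolding time_deriv_def force_eq[OF d(1)] by (rule vector_derivative_at[OF d(3)])
  ultimately show "is_global_solution \<gamma> X"
    unfolding is_global_solution_def V using d(1) motion_continuous(1)[OF m] by auto
qed

lemma global_solution_imp_motion:
  assumes "is_global_solution \<gamma> A"
  shows "motion (\<lambda>_. 1) \<gamma> UNIV A (time_deriv A)"
proof -
  have C: "C_infinity A" and GL: "A t \<in> GL_plus"
    and eq: "time_deriv (time_deriv A) t = force \<gamma> (A t)" for t
    using assms force_eq unfolding is_global_solution_def by (auto simp: image_subset_iff)
  have "(A has_vector_derivative time_deriv A t) (at t)" for t
    using C[unfolded C_infinity_def, rule_format, of 0 t]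
    by (simp add: time_deriv_def vector_derivative_works)
  moreover have "(time_deriv A has_vector_derivative time_deriv (time_deriv A) t) (at t)" for t
    using C[unfolded C_infinity_def, rule_format, of 1 t]
    by (simp add: time_deriv_def[of "time_deriv A"] vector_derivative_works)
  ultimately show ?thesis
    unfolding motion_def using GL eq by auto
qed

section \<open>Inversion of time\<close>

text \<open>The substitution \<open>B(s) = s A(1/s)\<close> that brings infinite time to \<open>0\<close>; \<open>inv_vel\<close> is the derivative
of \<open>B\<close>, computed by the chain rule.\<close>
definition inv_pos :: "(real \<Rightarrow> 'a::real_vector) \<Rightarrow> real \<Rightarrow> 'a" where
  "inv_pos X s = s *\<^sub>R X (inverse s)"

definition inv_vel :: "(real \<Rightarrow> 'a::real_vector) \<Rightarrow> (real \<Rightarrow> 'a) \<Rightarrow> real \<Rightarrow> 'a" where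
  "inv_vel X V s = X (inverse s) - inverse s *\<^sub>R V (inverse s)"

text \<open>The chain rule gives \<open>B'' = s powr (-3) * A''(1/s)\<close>, and homogeneity gives
\<open>F(A(1/s)) = s powr (3\<gamma> - 2) * F(B)\<close>. The exponents \<open>a\<close> and \<open>3\<gamma> - 5 - a\<close> are exchanged, so the
statement is used in both directions.\<close>
lemma motion_inversion:
  assumes m: "motion (\<lambda>t. t powr a) \<gamma> S X V"
  shows "motion (\<lambda>s. s powr (3 * \<gamma> - 5 - a)) \<gamma> {s. 0 < s \<and> inverse s \<in> S} (inv_pos X) (inv_vel X V)"
  unfolding motion_def
proof (intro ballI conjI)
  fix s assume "s \<in> {s. 0 < s \<and> inverse s \<in> S}"
  then have s: "0 < s" and sS: "inverse s \<in> S" by auto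
  have X: "X (inverse s) \<in> GL_plus" "(X has_vector_derivative V (inverse s)) (at (inverse s))"
    "(V has_vector_derivative inverse s powr a *\<^sub>R force \<gamma> (X (inverse s))) (at (inverse s))"
    using m sS unfolding motion_def by auto
  show "inv_pos X s \<in> GL_plus"
    unfolding inv_pos_def using GL_plus_scaleR[OF s X(1)] .
  have r: "(inverse has_real_derivative - (inverse s ^ 2)) (at s)"
    using DERIV_inverse[of s] s by (simp add: numeral_2_eq_2)
  then have i: "(inverse has_vector_derivative - (inverse s ^ 2)) (at s)"
    by (simp add: has_real_derivative_iff_has_vector_derivative)
  have dX: "((\<lambda>s. X (inverse s)) has_vector_derivative - (inverse s ^ 2) *\<^sub>R V (inverse s)) (at s)"
    using vector_diff_chain_at[OF i X(2)] by (simp add: o_def)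
  have dV: "((\<lambda>s. V (inverse s)) has_vector_derivative
      - (inverse s ^ 2) *\<^sub>R (inverse s powr a *\<^sub>R force \<gamma> (X (inverse s)))) (at s)"
    using vector_diff_chain_at[OF i X(3)] by (simp add: o_def)
  have "(inv_pos X has_vector_derivative s *\<^sub>R (- (inverse s ^ 2) *\<^sub>R V (inverse s)) + 1 *\<^sub>R X (inverse s)) (at s)"
    unfolding inv_pos_def[abs_def] by (rule has_vector_derivative_scaleR[OF DERIV_ident dX])
  moreover have "s * inverse s ^ 2 = inverse s"
    using s by (simp add: power2_eq_square)
  ultimately show "(inv_pos X has_vector_derivative inv_vel X V s) (at s)"
    unfolding inv_vel_def by simp
  have "(inv_vel X V has_vector_derivative - (inverse s ^ 2) *\<^sub>R V (inverse s) -
      (inverse s *\<^sub>R (- (inverse s ^ 2) *\<^sub>R (inverse s powr a *\<^sub>R force \<gamma> (X (inverse s)))) +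
       (- (inverse s ^ 2)) *\<^sub>R V (inverse s))) (at s)"
    unfolding inv_vel_def[abs_def]
    by (intro has_vector_derivative_diff dX has_vector_derivative_scaleR[OF r dV])
  moreover have "s powr (3 * \<gamma> - 5 - a) *\<^sub>R force \<gamma> (inv_pos X s)
      = inverse s ^ 3 *\<^sub>R (inverse s powr a *\<^sub>R force \<gamma> (X (inverse s)))"
  proof -
    have "s powr (3 * \<gamma> - 5 - a) * s powr (2 - 3 * \<gamma>) = s powr (- a - 3)"
      by (simp add: algebra_simps flip: powr_add)
    also have "\<dots> = inverse s ^ 3 * inverse s powr a"
    proof -
      have "inverse s powr a = inverse (s powr a)"
        using s by (simp add: powr_def ln_inverse exp_minus)
      then show ?thesis
        using s by (simp add: powr_diff powr_minus divide_inverse power_inverse mult.commute)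
    qed
    finally show ?thesis
      unfolding inv_pos_def force_scaleR[OF s X(1)] by simp
  qed
  ultimately show "(inv_vel X V has_vector_derivative s powr (3 * \<gamma> - 5 - a) *\<^sub>R force \<gamma> (inv_pos X s)) (at s)"
    by (simp add: power2_eq_square power3_eq_cube mult.assoc)
qed

lemma inv_pos_involution: "s \<noteq> 0 \<Longrightarrow> inv_pos (inv_pos X) s = X s"
  by (simp add: inv_pos_def)

text \<open>A second derivative dominated by the integrable function \<open>C * t powr a\<close> makes the velocity, and
hence the position, converge at time \<open>0\<close>. The extensions are obtained by integrating backwards
from \<open>T\<close>.\<close>
lemma extends_to_singular_time:
  fixes Z V h :: "real \<Rightarrow> 'a::euclidean_space"
  assumes T: "0 < T" and a: "a > -1"
    and dZ: "\<And>t. t \<in> {0<..T} \<Longrightarrow> (Z has_vector_derivative V t) (at t)"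
    and dV: "\<And>t. t \<in> {0<..T} \<Longrightarrow> (V has_vector_derivative h t) (at t)"
    and h: "continuous_on {0<..T} h" "\<And>t. t \<in> {0<..T} \<Longrightarrow> norm (h t) \<le> C * t powr a"
  shows "\<exists>Zb Vb. continuous_on {0..T} Vb \<and>
    (\<forall>t\<in>{0..T}. (Zb has_vector_derivative Vb t) (at t within {0..T})) \<and>
    (\<forall>t\<in>{0<..T}. Zb t = Z t \<and> Vb t = V t)"
proof -
  have "h integrable_on {0<..T}"
  proof (rule measurable_bounded_by_integrable_imp_integrable)
    show "h \<in> borel_measurable (lebesgue_on {0<..T})"
      by (rule continuous_imp_measurable_on_sets_lebesgue[OF h(1)]) simp
    show "(\<lambda>t. C * t powr a) integrable_on {0<..T}"
      using integrable_on_powr_from_0'[OF a, of T] T by (intro integrable_on_mult_right) auto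
  qed (use h(2) in auto)
  then have hint: "h integrable_on {0..T}"
    by (rule integrable_spike_set) (auto intro: negligible_subset[of "{0}"])
  define Vb where "Vb t = V T - integral {t..T} h" for t
  have Vb: "Vb t = V t" if "t \<in> {0<..T}" for t
  proof -
    have "(h has_integral V T - V t) {t..T}"
      using that by (intro fundamental_theorem_of_calculus) (auto intro!: has_vector_derivative_at_within dV)
    from integral_unique[OF this] show ?thesis by (simp add: Vb_def)
  qed
  have contVb: "continuous_on {0..T} Vb"
    unfolding Vb_def[abs_def] by (intro continuous_intros indefinite_integral_continuous_1' hint)
  define I where "I t = integral {0..t} Vb" for t
  define Zb where "Zb t = Z T + (I t - I T)" for t
  have Zb: "Zb t = Z t" if t: "t \<in> {0<..T}" for t
  proof -
    have "(V has_integral Z T - Z t) {t..T}"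
      using that by (intro fundamental_theorem_of_calculus) (auto intro!: has_vector_derivative_at_within dZ)
    then have "(Vb has_integral Z T - Z t) {t..T}"
      by (rule has_integral_eq[rotated]) (use Vb t in auto)
    moreover have "I t + integral {t..T} Vb = I T"
      unfolding I_def using t by (intro Henstock_Kurzweil_Integration.integral_combine integrable_continuous_real contVb) auto
    ultimately show ?thesis
      unfolding Zb_def by (auto dest!: integral_unique simp: algebra_simps)
  qed
  have "(Zb has_vector_derivative Vb t) (at t within {0..T})" if "t \<in> {0..T}" for t
    using integral_has_vector_derivative[OF contVb that]
    unfolding Zb_def[abs_def] I_def[abs_def] by (auto intro!: derivative_eq_intros)
  with contVb Vb Zb show ?thesis by blast
qed

lemma has_vector_derivative_imp_quotient_at_0:
  assumes "(f has_vector_derivative d) (at 0 within {0..T})" "0 < (T::real)"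
  shows "((\<lambda>s. inverse s *\<^sub>R (f s - f 0)) \<longlongrightarrow> d) (at_right 0)"
proof -
  have "((\<lambda>s. norm (f s - f 0 - s *\<^sub>R d) / norm s) \<longlongrightarrow> 0) (at_right 0)"
    using assms unfolding has_vector_derivative_def has_derivative_iff_norm
    by (simp add: at_within_Icc_at_right)
  moreover have "\<forall>\<^sub>F s in at_right 0. norm (f s - f 0 - s *\<^sub>R d) / norm s
      = norm (inverse s *\<^sub>R (f s - f 0) - d)"
  proof (rule eventually_at_rightI[of 0 1])
    fix s :: real assume "s \<in> {0<..<1}"
    then have "inverse s *\<^sub>R (f s - f 0) - d = inverse s *\<^sub>R (f s - f 0 - s *\<^sub>R d)" "0 < s"
      by (auto simp: algebra_simps)
    then show "norm (f s - f 0 - s *\<^sub>R d) / norm s = norm (inverse s *\<^sub>R (f s - f 0) - d)"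
      by (simp add: divide_inverse mult.commute)
  qed simp
  ultimately have "((\<lambda>s. norm (inverse s *\<^sub>R (f s - f 0) - d)) \<longlongrightarrow> 0) (at_right 0)"
    by (rule Lim_transform_eventually)
  then show ?thesis
    using LIM_zero_iff tendsto_norm_zero_iff by blast
qed

text \<open>All norms on matrices are equivalent, so that the operator norm may be replaced by the library norm in limits.\<close>
lemma op_norm_tendsto_0_iff:
  fixes f :: "real \<Rightarrow> real^3^3"
  shows "((\<lambda>t. op_norm (f t)) \<longlongrightarrow> 0) F \<longleftrightarrow> (f \<longlongrightarrow> 0) F"
proof
  assume op: "((\<lambda>t. op_norm (f t)) \<longlongrightarrow> 0) F"
  have "((\<lambda>t. f t $ i $ j) \<longlongrightarrow> 0) F" for i j
    by (rule Lim_null_comparison[OF always_eventually op])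
       (simp add: op_norm_def matrix_component_le_onorm)
  then show "(f \<longlongrightarrow> 0) F"
    by (intro vec_tendstoI) simp
next
  assume f: "(f \<longlongrightarrow> 0) F"
  have "((\<lambda>t. f t $ i $ j) \<longlongrightarrow> 0) F" for i j
    using tendsto_vec_nth[OF tendsto_vec_nth[OF f, of i], of j] by simp
  then have s: "((\<lambda>t. \<Sum>i\<in>UNIV. \<Sum>j\<in>UNIV. \<bar>f t $ i $ j\<bar>) \<longlongrightarrow> 0) F"
    by (intro tendsto_null_sum tendsto_rabs_zero)
  have "norm (op_norm (f t)) \<le> (\<Sum>i\<in>UNIV. \<Sum>j\<in>UNIV. \<bar>f t $ i $ j\<bar>)" for t
    using onorm_le_matrix_component_sum[of "f t"] onorm_pos_le[of "(*v) (f t)"]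
    by (simp add: op_norm_def matrix_vector_mul_bounded_linear)
  then show "((\<lambda>t. op_norm (f t)) \<longlongrightarrow> 0) F"
    by (intro Lim_null_comparison[OF always_eventually s]) blast
qed

text \<open>Dividing \<open>B(s) - A\<^sub>1\<close> by \<open>s\<close> gives \<open>A(1/s) - A\<^sub>1 / s\<close>: to be asymptotic to \<open>A\<^sub>0 + t A\<^sub>1\<close> is to have value
\<open>A\<^sub>1\<close> and derivative \<open>A\<^sub>0\<close> at the inverted time \<open>0\<close>.\<close>
lemma asymptotic_to_iff_quotient:
  "asymptotic_to A A1 A0 \<longleftrightarrow> ((\<lambda>s. inverse s *\<^sub>R (inv_pos A s - A1)) \<longlongrightarrow> A0) (at_right 0)"
proof -
  have "asymptotic_to A A1 A0 \<longleftrightarrow> ((\<lambda>s. A (inverse s) - (A0 + inverse s *\<^sub>R A1)) \<longlongrightarrow> 0) (at_right 0)"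
    unfolding asymptotic_to_def op_norm_tendsto_0_iff filterlim_at_top_to_right ..
  also have "\<dots> \<longleftrightarrow> ((\<lambda>s. inverse s *\<^sub>R (inv_pos A s - A1) - A0) \<longlongrightarrow> 0) (at_right 0)"
    by (rule filterlim_cong[OF refl refl], rule eventually_at_rightI[of 0 1])
       (auto simp: inv_pos_def algebra_simps)
  also have "\<dots> \<longleftrightarrow> ((\<lambda>s. inverse s *\<^sub>R (inv_pos A s - A1)) \<longlongrightarrow> A0) (at_right 0)"
    by (rule LIM_zero_iff)
  finally show ?thesis .
qed

lemma asymptotic_to_imp_inv_pos_tendsto:
  assumes "asymptotic_to A A1 A0"
  shows "(inv_pos A \<longlongrightarrow> A1) (at_right 0)"
proof -
  have "((\<lambda>s. s *\<^sub>R (inverse s *\<^sub>R (inv_pos A s - A1))) \<longlongrightarrow> 0 *\<^sub>R A0) (at_right 0)"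
    using assms unfolding asymptotic_to_iff_quotient by (intro tendsto_scaleR tendsto_ident_at)
  moreover have "\<forall>\<^sub>F s in at_right 0. s *\<^sub>R (inverse s *\<^sub>R (inv_pos A s - A1)) = inv_pos A s - A1"
    by (rule eventually_at_rightI[of 0 1]) auto
  ultimately have "((\<lambda>s. inv_pos A s - A1) \<longlongrightarrow> 0) (at_right 0)"
    by (simp add: tendsto_cong)
  then show ?thesis by (rule LIM_zero_cancel)
qed

lemma asymptotic_data_unique:
  assumes "asymptotic_to A A1 A0" "asymptotic_to A B1 B0"
  shows "A1 = B1 \<and> A0 = B0"
proof -
  have 1: "A1 = B1"
    using tendsto_unique[OF trivial_limit_at_right_real] asymptotic_to_imp_inv_pos_tendsto assms by blast
  have "A0 = B0"
    by (rule tendsto_unique[OF trivial_limit_at_right_real, of "\<lambda>s. inverse s *\<^sub>R (inv_pos A s - A1)"])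
       (use assms 1 in \<open>simp_all add: asymptotic_to_iff_quotient\<close>)
  with 1 show ?thesis by blast
qed

lemma asymptotic_to_of_extension:
  assumes "(Z has_vector_derivative A0) (at 0 within {0..T})" "0 < T" "Z 0 = A1"
    and eq: "\<And>s. s \<in> {0<..<T} \<Longrightarrow> inv_pos A s = Z s"
  shows "asymptotic_to A A1 A0"
proof -
  have "((\<lambda>s. inverse s *\<^sub>R (Z s - A1)) \<longlongrightarrow> A0) (at_right 0)"
    using has_vector_derivative_imp_quotient_at_0[OF assms(1,2)] assms(3) by simp
  moreover have "\<forall>\<^sub>F s in at_right 0. inverse s *\<^sub>R (Z s - A1) = inverse s *\<^sub>R (inv_pos A s - A1)"
    by (rule eventually_at_rightI[of 0 T]) (use assms in auto)
  ultimately show ?thesis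
    unfolding asymptotic_to_iff_quotient by (rule Lim_transform_eventually)
qed

lemma motion_inverted:
  assumes "motion (\<lambda>_. 1) \<gamma> UNIV A V"
  shows "motion (\<lambda>s. s powr (3 * \<gamma> - 5)) \<gamma> {0<..} (inv_pos A) (inv_vel A V)"
proof -
  have "motion (\<lambda>t. t powr 0) \<gamma> {0<..} A V"
    by (rule motion_cong_open[OF motion_subset[OF assms]]) auto
  from motion_inversion[OF this] show ?thesis
    by (simp add: greaterThan_def)
qed

section \<open>Motions with prescribed asymptotics\<close>

text \<open>The initial value problem with weight \<open>s powr (3\<gamma> - 5)\<close> and data \<open>(A\<^sub>1, A\<^sub>0)\<close> at \<open>s = 0\<close> has a solution for a
short time. Its inversion is a motion near infinity, which is continued to the whole line from any
time \<open>b\<close> in its domain.\<close>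
proposition asymptotic_motion_exists:
  assumes \<gamma>: "\<gamma> > 4/3" and A1: "A1 \<in> GL_plus"
  shows "\<exists>A V. motion (\<lambda>_. 1) \<gamma> UNIV A V \<and> asymptotic_to A A1 A0"
proof -
  define w where "w s = s powr (3 * \<gamma> - 5)" for s :: real
  define \<delta> where "\<delta> = det A1 / 2"
  define R where "R = norm A1 + 1"
  have \<delta>: "0 < \<delta>" "\<delta> < det A1" and R: "0 < R" "norm A1 < R"
    using A1 by (auto simp: \<delta>_def R_def GL_plus_def add_nonneg_pos)
  obtain L where L: "L-lipschitz_on UNIV (truncated_force \<gamma> \<delta> R)"
    using truncated_force_lipschitz[OF \<delta>(1) R(1)] by blast
  have w: "w integrable_on {0..1}"
    unfolding w_def[abs_def] using \<gamma> by (intro integrable_on_powr_from_0) auto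
  have "\<exists>Z V. solves_ivp w (truncated_force \<gamma> \<delta> R) 1 A1 A0 Z V"
    by (rule solves_ivp_exists[OF L w]) (auto simp: w_def)
  then obtain Z V where ZV: "solves_ivp w (truncated_force \<gamma> \<delta> R) 1 A1 A0 Z V" by blast
  have Z0: "Z 0 = A1" using ZV by (simp add: solves_ivp_def)
  have "continuous_on {0..1} (\<lambda>s. det (Z s))" "continuous_on {0..1} (\<lambda>s. norm (Z s))"
    by (intro continuous_intros solves_ivp_continuous[OF ZV])+
  then have "((\<lambda>s. det (Z s)) \<longlongrightarrow> det (Z 0)) (at_right 0)" "((\<lambda>s. norm (Z s)) \<longlongrightarrow> norm (Z 0)) (at_right 0)"
    by (auto simp: continuous_on_def at_within_Icc_at_right dest!: bspec[of _ _ 0])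
  then have "\<forall>\<^sub>F s in at_right 0. \<delta> < det (Z s) \<and> norm (Z s) < R"
    using \<delta> R Z0 by (auto intro!: eventually_conj order_tendstoD)
  then obtain T0 where T0: "T0 > 0" "\<And>s. 0 < s \<Longrightarrow> s < T0 \<Longrightarrow> \<delta> < det (Z s) \<and> norm (Z s) < R"
    by (auto simp: eventually_at_right_field)
  define T where "T = min 1 (T0 / 2)"
  have T: "0 < T" "T \<le> 1" using T0 by (auto simp: T_def)
  have good: "\<delta> < det (Z s) \<and> norm (Z s) < R" if "s \<in> {0..T}" for s
    using T0 \<delta> R Z0 that by (cases "s = 0") (auto simp: T_def)
  have sol: "solves_ivp w (force \<gamma>) T A1 A0 Z V"
    by (rule solves_ivp_cong[OF solves_ivp_subinterval[OF ZV T(2)]])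
       (use good in \<open>auto simp: truncated_force_eq less_imp_le\<close>)
  have "motion w \<gamma> {0<..<T} Z V"
    by (rule solves_ivp_force_imp_motion[OF sol])
       (use good \<delta> in \<open>force simp: GL_plus_def w_def intro!: continuous_intros\<close>)+
  from motion_inversion[OF this[unfolded w_def[abs_def]]]
  have "motion (\<lambda>s. s powr 0) \<gamma> {s. 0 < s \<and> inverse s \<in> {0<..<T}} (inv_pos Z) (inv_vel Z V)"
    by simp
  also have "{s. 0 < s \<and> inverse s \<in> {0<..<T}} = {inverse T<..}"
  proof (intro set_eqI iffI)
    fix s assume "s \<in> {inverse T<..}"
    then have "inverse T < s" "0 < s" using T by (auto intro: less_trans[of 0 "inverse T"])
    then show "s \<in> {s. 0 < s \<and> inverse s \<in> {0<..<T}}"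
      using less_imp_inverse_less[of "inverse T" s] T by simp
  qed (use T less_imp_inverse_less in force)
  finally have m: "motion (\<lambda>_. 1) \<gamma> {inverse T<..} (inv_pos Z) (inv_vel Z V)"
    by (rule motion_cong_open) (use T in \<open>auto dest: less_trans[of 0, rotated]\<close>)
  define b where "b = inverse T + 1"
  have b: "b \<in> {inverse T<..}" by (simp add: b_def)
  then have "inv_pos Z b \<in> GL_plus" using m by (simp add: motion_def)
  then obtain A W where AW: "motion (\<lambda>_. 1) \<gamma> UNIV A W" "A b = inv_pos Z b" "W b = inv_vel Z V b"
    using motion_exists[of \<gamma> "inv_pos Z b" b "inv_vel Z V b"] \<gamma> by auto
  have AZ: "A t = inv_pos Z t" if "t > inverse T" for t
  proof -
    have "closed_segment b t \<subseteq> {inverse T<..}"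
      using b that by (auto simp: closed_segment_eq_real_ivl split: if_splits)
    from motion_unique[OF motion_subset[OF AW(1)] m AW(2,3) this] show ?thesis by simp
  qed
  have "asymptotic_to A A1 A0"
  proof (rule asymptotic_to_of_extension[where Z = Z and T = T])
    have "V 0 = A0" using solves_ivp_initial_velocity[OF sol] T by simp
    then show "(Z has_vector_derivative A0) (at 0 within {0..T})"
      using sol T unfolding solves_ivp_def by auto
    fix s assume "s \<in> {0<..<T}"
    then have "inverse T < inverse s" "s \<noteq> 0" by (auto intro: less_imp_inverse_less)
    then show "inv_pos A s = Z s"
      using AZ inv_pos_involution[of s Z] by (simp add: inv_pos_def)
  qed (use T Z0 in auto)
  with AW(1) show ?thesis by blast
qed

lemma motion_force_continuous:
  assumes "motion w \<gamma> S Z V" "continuous_on S w"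
  shows "continuous_on S (\<lambda>s. w s *\<^sub>R force \<gamma> (Z s))"
  using assms(1)
  by (intro continuous_intros assms(2) continuous_on_force motion_continuous(1)[OF assms(1)])
     (auto simp: motion_def)

lemma inverted_motion_extends:
  assumes m: "motion (\<lambda>_. 1) \<gamma> UNIV A V" and T: "0 < T" and a: "a > -1"
    and bound: "\<And>s. s \<in> {0<..T} \<Longrightarrow> norm (s powr (3 * \<gamma> - 5) *\<^sub>R force \<gamma> (inv_pos A s)) \<le> C * s powr a"
  shows "\<exists>Z W. continuous_on {0..T} W \<and>
    (\<forall>s\<in>{0..T}. (Z has_vector_derivative W s) (at s within {0..T})) \<and>
    (\<forall>s\<in>{0<..T}. Z s = inv_pos A s \<and> W s = inv_vel A V s)"
proof (rule extends_to_singular_time[OF T a _ _ _ bound])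
  note mi = motion_inverted[OF m]
  show "continuous_on {0<..T} (\<lambda>s. s powr (3 * \<gamma> - 5) *\<^sub>R force \<gamma> (inv_pos A s))"
    by (rule motion_force_continuous[OF motion_subset[OF mi]]) (auto intro!: continuous_intros)
qed (use motion_inverted[OF m] in \<open>auto simp: motion_def\<close>)

text \<open>The hypothesis controls only the values of the inverted motion near \<open>0\<close>, but the initial value problem
also involves its velocity. Convergence to \<open>A\<^sub>1\<close> bounds the force, hence the second derivative by a
multiple of the weight, and the velocity converges too; its limit must then be \<open>A\<^sub>0\<close>.\<close>
lemma asymptotic_motion_solves_ivp:
  assumes m: "motion (\<lambda>_. 1) \<gamma> UNIV A V" and as: "asymptotic_to A A1 A0"
    and A1: "A1 \<in> GL_plus" and \<gamma>: "\<gamma> > 4/3"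
  shows "\<exists>T>0. \<exists>Z W. solves_ivp (\<lambda>s. s powr (3 * \<gamma> - 5)) (force \<gamma>) T A1 A0 Z W \<and>
    Z ` {0..T} \<subseteq> GL_plus \<and> (\<forall>s\<in>{0<..T}. Z s = inv_pos A s \<and> W s = inv_vel A V s)"
proof -
  note mi = motion_inverted[OF m]
  have lim: "(inv_pos A \<longlongrightarrow> A1) (at_right 0)"
    by (rule asymptotic_to_imp_inv_pos_tendsto[OF as])
  have op: "open (GL_plus)"
    unfolding GL_plus_def by (intro open_Collect_less continuous_intros)
  have "continuous_on GL_plus (force \<gamma>)"
    using continuous_on_force[OF continuous_on_id, of GL_plus \<gamma>] by simp
  then have "isCont (force \<gamma>) A1"
    using A1 op continuous_on_eq_continuous_at by blast
  from isCont_tendsto_compose[OF this lim]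
  have "((\<lambda>s. norm (force \<gamma> (inv_pos A s))) \<longlongrightarrow> norm (force \<gamma> A1)) (at_right 0)"
    by (rule tendsto_norm)
  then have "\<forall>\<^sub>F s in at_right 0. norm (force \<gamma> (inv_pos A s)) < norm (force \<gamma> A1) + 1"
    by (rule order_tendstoD) simp
  then obtain T0 where T0: "T0 > 0" "\<And>s. 0 < s \<Longrightarrow> s < T0 \<Longrightarrow> norm (force \<gamma> (inv_pos A s)) < norm (force \<gamma> A1) + 1"
    by (auto simp: eventually_at_right_field)
  have exponent: "3 * \<gamma> - 5 > -1" using \<gamma> by simp
  define T where "T = T0 / 2"
  have T: "0 < T" "T < T0" using T0(1) by (auto simp: T_def)
  have bound: "norm (s powr (3 * \<gamma> - 5) *\<^sub>R force \<gamma> (inv_pos A s)) \<le> (norm (force \<gamma> A1) + 1) * s powr (3 * \<gamma> - 5)"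
    if "s \<in> {0<..T}" for s
    using T0(2)[of s] T that by (simp add: mult.commute mult_left_mono less_imp_le)
  obtain Z W where W: "continuous_on {0..T} W"
    and Z: "\<And>s. s \<in> {0..T} \<Longrightarrow> (Z has_vector_derivative W s) (at s within {0..T})"
    and eq: "\<And>s. s \<in> {0<..T} \<Longrightarrow> Z s = inv_pos A s \<and> W s = inv_vel A V s"
    using inverted_motion_extends[OF m T(1) exponent bound] by blast
  have "(Z has_vector_derivative W 0) (at 0 within {0..T})"
    using Z T by auto
  from asymptotic_to_of_extension[OF this T(1) refl, of A] eq
  have "asymptotic_to A (Z 0) (W 0)" by auto
  then have init: "Z 0 = A1" "W 0 = A0"
    using asymptotic_data_unique[OF _ as] by auto
  have "solves_ivp (\<lambda>s. s powr (3 * \<gamma> - 5)) (force \<gamma>) T (Z 0) (W 0) Z W"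
  proof (rule solves_ivpI[OF W Z])
    fix s assume s: "s \<in> {0<..<T}"
    have "(inv_vel A V has_vector_derivative s powr (3 * \<gamma> - 5) *\<^sub>R force \<gamma> (inv_pos A s)) (at s)"
      using mi s by (auto simp: motion_def)
    then have "(W has_vector_derivative s powr (3 * \<gamma> - 5) *\<^sub>R force \<gamma> (inv_pos A s)) (at s)"
      by (rule has_vector_derivative_transform_within_open[of _ _ _ "{0<..<T}"]) (use s eq in auto)
    then show "(W has_vector_derivative s powr (3 * \<gamma> - 5) *\<^sub>R force \<gamma> (Z s)) (at s)"
      using eq[of s] s by simp
  qed
  moreover have "Z ` {0..T} \<subseteq> GL_plus"
  proof
    fix B assume "B \<in> Z ` {0..T}"
    then obtain s where s: "s \<in> {0..T}" "B = Z s" by blast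
    show "B \<in> GL_plus"
    proof (cases "s = 0")
      case False
      then show ?thesis using s eq[of s] mi by (auto simp: motion_def)
    qed (use s init A1 in simp)
  qed
  ultimately show ?thesis using T(1) eq init by blast
qed

text \<open>The inverted motions solve the same initial value problem near \<open>0\<close>, so the motions agree at one large
time, together with their velocities, and therefore always.\<close>
proposition asymptotic_motion_unique:
  assumes m: "motion (\<lambda>_. 1) \<gamma> UNIV A V" "motion (\<lambda>_. 1) \<gamma> UNIV A' V'"
    and as: "asymptotic_to A A1 A0" "asymptotic_to A' A1 A0"
    and A1: "A1 \<in> GL_plus" and \<gamma>: "\<gamma> > 4/3"
  shows "A = A'"
proof -
  define w where "w s = s powr (3 * \<gamma> - 5)" for s :: real
  obtain T Z W where T: "T > 0" and Z: "solves_ivp w (force \<gamma>) T A1 A0 Z W" "Z ` {0..T} \<subseteq> GL_plus"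
    and eq: "\<And>s. s \<in> {0<..T} \<Longrightarrow> Z s = inv_pos A s \<and> W s = inv_vel A V s"
    using asymptotic_motion_solves_ivp[OF m(1) as(1) A1 \<gamma>] unfolding w_def by blast
  obtain T' Z' W' where T': "T' > 0" and Z': "solves_ivp w (force \<gamma>) T' A1 A0 Z' W'" "Z' ` {0..T'} \<subseteq> GL_plus"
    and eq': "\<And>s. s \<in> {0<..T'} \<Longrightarrow> Z' s = inv_pos A' s \<and> W' s = inv_vel A' V' s"
    using asymptotic_motion_solves_ivp[OF m(2) as(2) A1 \<gamma>] unfolding w_def by blast
  define \<tau> where "\<tau> = min T T'"
  have \<tau>: "0 < \<tau>" "\<tau> \<le> T" "\<tau> \<le> T'" using T T' by (auto simp: \<tau>_def)
  have w: "w integrable_on {0..\<tau>}"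
    unfolding w_def[abs_def] using \<gamma> \<tau> by (intro integrable_on_powr_from_0) auto
  have "Z \<tau> = Z' \<tau> \<and> W \<tau> = W' \<tau>"
  proof (rule solves_ivp_force_unique[OF w])
    show "solves_ivp w (force \<gamma>) \<tau> A1 A0 Z W" "solves_ivp w (force \<gamma>) \<tau> A1 A0 Z' W'"
      using solves_ivp_subinterval Z(1) Z'(1) \<tau> by blast+
    show "Z ` {0..\<tau>} \<subseteq> GL_plus" "Z' ` {0..\<tau>} \<subseteq> GL_plus"
      using Z(2) Z'(2) \<tau> by (auto simp: image_subset_iff)
  qed (use \<tau> in \<open>auto simp: w_def\<close>)
  then have e: "inv_pos A \<tau> = inv_pos A' \<tau>" "inv_vel A V \<tau> = inv_vel A' V' \<tau>"
    using eq[of \<tau>] eq'[of \<tau>] \<tau> by auto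
  then have "A (inverse \<tau>) = A' (inverse \<tau>)" "V (inverse \<tau>) = V' (inverse \<tau>)"
    using \<tau> by (auto simp: inv_pos_def inv_vel_def)
  from motion_unique[OF m this] show ?thesis by auto
qed

section \<open>Asymptotics of arbitrary motions\<close>

lemma motion_linear_growth:
  assumes m: "motion (\<lambda>_. 1) \<gamma> UNIV A V" and \<gamma>: "\<gamma> > 1"
  shows "\<exists>M\<ge>0. \<forall>t\<ge>0. norm (A t) \<le> norm (A 0) + M * t"
proof -
  have "\<exists>c. \<forall>t\<in>UNIV. (V t \<bullet> V t) / 2 + 1 * potential \<gamma> (A t) = c"
  proof (rule has_field_derivative_zero_constant)
    fix t :: real
    have "((\<lambda>t. (V t \<bullet> V t) / 2 + 1 * potential \<gamma> (A t)) has_real_derivative 0 * potential \<gamma> (A t)) (at t)"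
      by (rule energy_has_derivative) (use m \<gamma> in \<open>auto simp: motion_def\<close>)
    then show "((\<lambda>t. (V t \<bullet> V t) / 2 + 1 * potential \<gamma> (A t)) has_real_derivative 0) (at t)" by simp
  qed simp
  then obtain c where c: "\<And>t. (V t \<bullet> V t) / 2 + potential \<gamma> (A t) = c" by auto
  have "A t \<in> GL_plus" for t using m by (auto simp: motion_def)
  then have pot: "potential \<gamma> (A t) > 0" for t using \<gamma> potential_pos by blast
  have c0: "0 \<le> c"
    using c[of 0] pot[of 0] inner_ge_zero[of "V 0"] by linarith
  have Vb: "norm (V t) \<le> sqrt (2 * c)" for t
    by (rule norm_le_sqrt_of_kinetic) (use c[of t] pot[of t] in linarith)
  have "norm (A t) \<le> norm (A 0) + sqrt (2 * c) * t" if t: "t \<ge> 0" for t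
  proof -
    have "(V has_integral A t - A 0) {0..t}"
      by (rule fundamental_theorem_of_calculus[OF t])
         (use m in \<open>simp add: motion_def has_vector_derivative_at_within\<close>)
    then have "norm (A t - A 0) \<le> sqrt (2 * c) * measure lborel {0..t}"
      by (intro has_integral_bound_real[of _ "{}" V]) (use Vb c0 in auto)
    then show ?thesis
      using t norm_triangle_sub[of "A t" "A 0"] by simp
  qed
  then show ?thesis using c0 by (intro exI[of _ "sqrt (2 * c)"]) auto
qed

text \<open>For \<open>b > 0\<close> the energy itself is nondecreasing in \<open>s\<close>. For \<open>b < 0\<close> it may grow towards \<open>s = 0\<close>, but no
faster than \<open>s powr b\<close>: the factor \<open>s powr k\<close> with \<open>k = max 0 (- b)\<close> compensates, since
\<open>(s powr k * e)' = s powr (k - 1) * (k |W|\<^sup>2 / 2 + (k + b) * s powr b * U)\<close> has no negative term.\<close>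
lemma inverted_potential_bound:
  assumes m: "motion (\<lambda>s. s powr b) \<gamma> {0<..} Z W" and \<gamma>: "\<gamma> > 1"
  shows "\<exists>C>0. \<forall>s\<in>{0<..1}. potential \<gamma> (Z s) \<le> C * s powr (- max b 0)"
proof -
  define k where "k = max 0 (- b)"
  have k: "0 \<le> k" "0 \<le> k + b" unfolding k_def by auto
  define e where "e s = (W s \<bullet> W s) / 2 + s powr b * potential \<gamma> (Z s)" for s
  have GL: "Z s \<in> GL_plus" if "0 < s" for s using m that by (auto simp: motion_def)
  have pot: "potential \<gamma> (Z s) > 0" if "0 < s" for s
    using potential_pos[OF GL[OF that] \<gamma>] .
  have de: "(e has_real_derivative b * s powr (b - 1) * potential \<gamma> (Z s)) (at s)" if s: "0 < s" for s
    unfolding e_def[abs_def]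
    by (rule energy_has_derivative) (use m s \<gamma> in \<open>auto simp: motion_def intro!: derivative_eq_intros\<close>)
  have mono: "s powr k * e s \<le> 1 powr k * e 1" if s: "s \<in> {0<..1}" for s
  proof (rule DERIV_nonneg_imp_nondecreasing[where f = "\<lambda>s. s powr k * e s"])
    fix x assume x: "s \<le> x" "x \<le> 1"
    then have x0: "0 < x" using s by auto
    have "((\<lambda>s. s powr k * e s) has_real_derivative
        k * x powr (k - 1) * e x + b * x powr (b - 1) * potential \<gamma> (Z x) * x powr k) (at x)"
      by (rule DERIV_mult[OF _ de[OF x0]]) (use x0 in \<open>auto intro!: derivative_eq_intros\<close>)
    moreover have "k * x powr (k - 1) * e x + b * x powr (b - 1) * potential \<gamma> (Z x) * x powr k
        = x powr (k - 1) * (k * ((W x \<bullet> W x) / 2) + (k + b) * (x powr b * potential \<gamma> (Z x)))"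
    proof -
      have "x powr (b - 1) * x powr k = x powr (k - 1) * x powr b"
        by (simp add: algebra_simps flip: powr_add)
      then show ?thesis unfolding e_def by (simp add: algebra_simps)
    qed
    ultimately have "((\<lambda>s. s powr k * e s) has_real_derivative
        x powr (k - 1) * (k * ((W x \<bullet> W x) / 2) + (k + b) * (x powr b * potential \<gamma> (Z x)))) (at x)"
      by simp
    moreover have "0 \<le> x powr (k - 1) * (k * ((W x \<bullet> W x) / 2) + (k + b) * (x powr b * potential \<gamma> (Z x)))"
      using pot[OF x0]
      by (intro mult_nonneg_nonneg[OF powr_ge_zero] add_nonneg_nonneg
          mult_nonneg_nonneg[OF k(1)] mult_nonneg_nonneg[OF k(2)]) auto
    ultimately show "\<exists>y. ((\<lambda>s. s powr k * e s) has_real_derivative y) (at x) \<and> 0 \<le> y"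
      by blast
  qed (use s in auto)
  have "potential \<gamma> (Z s) \<le> e 1 * s powr (- max b 0)" if s: "s \<in> {0<..1}" for s
  proof -
    have s0: "0 < s" using s by simp
    have kb: "k + b = max b 0" unfolding k_def by auto
    have "s powr (k + b) * potential \<gamma> (Z s) = s powr k * (s powr b * potential \<gamma> (Z s))"
      by (simp add: powr_add)
    also have "\<dots> \<le> s powr k * e s"
      unfolding e_def by (intro mult_left_mono) auto
    also have "\<dots> \<le> e 1" using mono[OF s] by simp
    finally show ?thesis
      using s0 unfolding kb powr_minus by (simp add: field_simps)
  qed
  moreover have "e 1 > 0"
    unfolding e_def using pot[of 1] by (simp add: add_nonneg_pos)
  ultimately show ?thesis by blast
qed

text \<open>The potential bound gives \<open>det B \<ge> c * s powr q\<close> with \<open>q < 1\<close> for the inverted motion \<open>B\<close>, and conservation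
of energy bounds \<open>B\<close> itself. Hence \<open>B''\<close> is at most of order \<open>s powr (b - \<gamma> q)\<close>, where \<open>b - \<gamma> q\<close> is \<open>b\<close> or
\<open>- q\<close> and in either case exceeds \<open>-1\<close>. So \<open>B\<close> extends differentiably to \<open>0\<close>, and there its
determinant cannot vanish.\<close>
proposition motion_has_asymptotic_data:
  assumes m: "motion (\<lambda>_. 1) \<gamma> UNIV A V" and \<gamma>: "4/3 < \<gamma>" "\<gamma> < 2"
  shows "\<exists>A1\<in>GL_plus. \<exists>A0. asymptotic_to A A1 A0"
proof -
  define b where "b = 3 * \<gamma> - 5"
  define q where "q = max b 0 / (\<gamma> - 1)"
  have \<gamma>1: "\<gamma> > 1" using \<gamma> by simp
  have q: "0 \<le> q" "q < 1"
    unfolding q_def b_def using \<gamma> by (auto simp: field_simps max_def)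
  note mi = motion_inverted[OF m, folded b_def]
  have GL: "inv_pos A s \<in> GL_plus" if "0 < s" for s using mi that by (auto simp: motion_def)
  obtain C where C: "C > 0" "\<And>s. s \<in> {0<..1} \<Longrightarrow> potential \<gamma> (inv_pos A s) \<le> C * s powr (- max b 0)"
    using inverted_potential_bound[OF mi \<gamma>1] by blast
  define c where "c = ((\<gamma> - 1) * C) powr (1 / (1 - \<gamma>))"
  have c: "c > 0" unfolding c_def using C(1) \<gamma>1 by simp
  have det_lower: "c * s powr q \<le> det (inv_pos A s)" if s: "s \<in> {0<..1}" for s
  proof -
    have s0: "0 < s" using s by simp
    have "- max b 0 * (1 / (1 - \<gamma>)) = q"
      unfolding q_def using \<gamma>1 by (simp add: field_simps)
    then have "c * s powr q = ((\<gamma> - 1) * (C * s powr (- max b 0))) powr (1 / (1 - \<gamma>))"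
      unfolding c_def using C(1) \<gamma>1 s0 by (simp add: powr_mult powr_powr mult.assoc)
    also have "\<dots> \<le> det (inv_pos A s)"
      by (rule det_ge_of_potential_le[OF GL[OF s0] \<gamma>1 C(2)[OF s]])
    finally show ?thesis .
  qed
  obtain M where M: "M \<ge> 0" "\<And>t. t \<ge> 0 \<Longrightarrow> norm (A t) \<le> norm (A 0) + M * t"
    using motion_linear_growth[OF m \<gamma>1] by blast
  have bounded: "norm (inv_pos A s) \<le> norm (A 0) + M" if s: "s \<in> {0<..1}" for s
  proof -
    have "norm (inv_pos A s) \<le> s * (norm (A 0) + M * inverse s)"
      unfolding inv_pos_def using M(2)[of "inverse s"] s by simp
    also have "\<dots> = s * norm (A 0) + M" using s by (simp add: field_simps)
    also have "\<dots> \<le> norm (A 0) + M" using s by (simp add: mult_left_le_one_le)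
    finally show ?thesis .
  qed
  have "bounded (cof ` cball 0 (norm (A 0) + M))"
    by (intro compact_imp_bounded compact_continuous_image continuous_on_cof continuous_on_id compact_cball)
  then obtain N where N: "\<forall>B\<in>cof ` cball 0 (norm (A 0) + M). norm B \<le> N"
    by (meson bounded_iff)
  have cofN: "norm (cof (inv_pos A s)) \<le> N" if "s \<in> {0<..1}" for s
    using N bounded[OF that] by auto
  have force_bound: "norm (s powr b *\<^sub>R force \<gamma> (inv_pos A s)) \<le> (c powr (- \<gamma>) * N) * s powr (b - \<gamma> * q)"
    if s: "s \<in> {0<..1}" for s
  proof -
    have s0: "0 < s" using s by simp
    have "det (inv_pos A s) powr (- \<gamma>) \<le> (c * s powr q) powr (- \<gamma>)"
      by (rule powr_mono2') (use det_lower[OF s] c s0 \<gamma>1 in auto)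
    also have "\<dots> = c powr (- \<gamma>) * s powr (- (\<gamma> * q))"
      using c by (simp add: powr_mult powr_powr mult.commute)
    finally have "norm (force \<gamma> (inv_pos A s)) \<le> (c powr (- \<gamma>) * s powr (- (\<gamma> * q))) * N"
      unfolding force_def using cofN[OF s] by (auto intro: mult_mono)
    then have "s powr b * norm (force \<gamma> (inv_pos A s)) \<le> s powr b * ((c powr (- \<gamma>) * s powr (- (\<gamma> * q))) * N)"
      by (rule mult_left_mono) simp
    also have "\<dots> = (c powr (- \<gamma>) * N) * s powr (b - \<gamma> * q)"
      by (simp add: powr_diff powr_minus field_simps)
    finally show ?thesis by simp
  qed
  have exponent: "b - \<gamma> * q > -1"
  proof (cases "b \<le> 0")
    case True
    then show ?thesis using \<gamma> unfolding q_def b_def by simp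
  next
    case False
    then have "b - \<gamma> * q = - q"
      unfolding q_def using \<gamma>1 by (simp add: field_simps)
    then show ?thesis using q by simp
  qed
  obtain Z W where Z: "\<And>s. s \<in> {0..1} \<Longrightarrow> (Z has_vector_derivative W s) (at s within {0..1})"
    and eq: "\<And>s. s \<in> {0<..1} \<Longrightarrow> Z s = inv_pos A s"
    using inverted_motion_extends[OF m, folded b_def, OF zero_less_one exponent force_bound] by blast
  have dZ: "(Z has_vector_derivative W 0) (at 0 within {0..1})" using Z by simp
  have as: "asymptotic_to A (Z 0) (W 0)"
    by (rule asymptotic_to_of_extension[OF dZ zero_less_one refl]) (use eq in auto)
  have d: "((\<lambda>s. det (Z s)) has_real_derivative cof (Z 0) \<bullet> W 0) (at 0 within {0..1})"
    by (rule det_has_derivative[OF dZ])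
  have detZ: "c * s powr q \<le> det (Z s)" if "s \<in> {0<..1}" for s
    using det_lower[OF that] eq[OF that] by simp
  \<comment> \<open>The lower bound on the determinant survives in the limit only as nonnegativity.\<close>
  have "det (Z 0) \<ge> 0"
  proof (rule tendsto_lowerbound)
    show "((\<lambda>s. det (Z s)) \<longlongrightarrow> det (Z 0)) (at_right 0)"
      using DERIV_continuous[OF d] by (simp add: continuous_within at_within_Icc_at_right)
    show "\<forall>\<^sub>F s in at_right 0. 0 \<le> det (Z s)"
    proof (rule eventually_at_rightI[of 0 1])
      fix s :: real assume "s \<in> {0<..<1}"
      then have "c * s powr q \<le> det (Z s)" by (intro detZ) auto
      then show "0 \<le> det (Z s)" using c by (meson mult_nonneg_nonneg less_imp_le order_trans powr_ge_zero)
    qed simp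
  qed simp
  moreover have "det (Z 0) \<noteq> 0"
  proof
    assume 0: "det (Z 0) = 0"
    \<comment> \<open>If \<open>det (Z 0) = 0\<close> then \<open>det (Z s) / s\<close> has a finite limit, although it is at least \<open>c * s powr (q - 1)\<close>.
        Multiplying by \<open>s powr (1 - q)\<close> gives \<open>c \<le> 0\<close> in the limit.\<close>
    have "((\<lambda>s. inverse s *\<^sub>R (det (Z s) - det (Z 0))) \<longlongrightarrow> cof (Z 0) \<bullet> W 0) (at_right 0)"
      by (rule has_vector_derivative_imp_quotient_at_0[of _ _ 1])
         (use d in \<open>simp_all add: has_real_derivative_iff_has_vector_derivative\<close>)
    moreover have "((\<lambda>s::real. s powr (1 - q)) \<longlongrightarrow> 0) (at_right 0)"
      by (rule tendsto_zero_powrI[OF tendsto_ident_at tendsto_const])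
         (use q in \<open>auto simp: eventually_at_right_field intro: exI[of _ 1]\<close>)
    ultimately have lim: "((\<lambda>s. (inverse s *\<^sub>R (det (Z s) - det (Z 0))) * s powr (1 - q)) \<longlongrightarrow> (cof (Z 0) \<bullet> W 0) * 0) (at_right 0)"
      by (rule tendsto_mult)
    have "\<forall>\<^sub>F s in at_right 0. c \<le> (inverse s *\<^sub>R (det (Z s) - det (Z 0))) * s powr (1 - q)"
    proof (rule eventually_at_rightI[of 0 1])
      fix s :: real assume s: "s \<in> {0<..<1}"
      then have "inverse s * (c * s powr q) * s powr (1 - q) \<le> inverse s * det (Z s) * s powr (1 - q)"
        by (intro mult_right_mono mult_left_mono detZ) auto
      moreover have "inverse s * (c * s powr q) * s powr (1 - q) = c"
        using s by (simp add: field_simps flip: powr_add)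
      ultimately show "c \<le> (inverse s *\<^sub>R (det (Z s) - det (Z 0))) * s powr (1 - q)"
        using 0 by simp
    qed simp
    from tendsto_lowerbound[OF lim this] c show False by simp
  qed
  ultimately have "Z 0 \<in> GL_plus" by (simp add: GL_plus_def)
  with as show ?thesis by blast
qed

section \<open>The wave operator\<close>

lemma ex1_asymptotic_solution:
  assumes "\<gamma> > 4/3" "A1 \<in> GL_plus"
  shows "\<exists>!A. is_global_solution \<gamma> A \<and> asymptotic_to A A1 A0"
proof (rule ex_ex1I)
  show "\<exists>A. is_global_solution \<gamma> A \<and> asymptotic_to A A1 A0"
    using asymptotic_motion_exists[OF assms] motion_imp_global_solution(1) by blast
qed (use asymptotic_motion_unique global_solution_imp_motion assms in blast)

lemma wave_plus_eq:
  assumes "\<gamma> > 4/3" "A1 \<in> GL_plus" "is_global_solution \<gamma> A" "asymptotic_to A A1 A0"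
  shows "wave_plus \<gamma> (A1, A0) = (A 0, time_deriv A 0)"
  using the1_equality[OF ex1_asymptotic_solution[OF assms(1,2), of A0], of A] assms(3,4)
  by (simp add: wave_plus_def Let_def)

theorem theorem6:
  fixes \<gamma> :: real
  shows "(\<gamma> > 4/3 \<longrightarrow>
            (\<forall>(A\<^sub>1, A\<^sub>0) \<in> data_space. \<exists>!A. is_global_solution \<gamma> A \<and> asymptotic_to A A\<^sub>1 A\<^sub>0) \<and>
            wave_plus \<gamma> ` data_space \<subseteq> data_space)
       \<and> (4/3 < \<gamma> \<and> \<gamma> < 2 \<longrightarrow> bij_betw (wave_plus \<gamma>) data_space data_space)"
proof -
  have ex1: "\<forall>(A1, A0) \<in> data_space. \<exists>!A. is_global_solution \<gamma> A \<and> asymptotic_to A A1 A0"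
    if "\<gamma> > 4/3"
    using ex1_asymptotic_solution[OF that] by (auto simp: data_space_def)
  have solution: "\<exists>A. is_global_solution \<gamma> A \<and> asymptotic_to A (fst d) (snd d) \<and>
      wave_plus \<gamma> d = (A 0, time_deriv A 0)"
    if "\<gamma> > 4/3" "d \<in> data_space" for d
  proof -
    have d: "fst d \<in> GL_plus" using that(2) by (auto simp: data_space_def)
    from ex1_asymptotic_solution[OF that(1) d, of "snd d"]
    obtain A where "is_global_solution \<gamma> A" "asymptotic_to A (fst d) (snd d)" by blast
    with wave_plus_eq[OF that(1) d this] show ?thesis by auto
  qed
  have into: "wave_plus \<gamma> ` data_space \<subseteq> data_space" if \<gamma>: "\<gamma> > 4/3"
  proof
    fix p assume "p \<in> wave_plus \<gamma> ` data_space"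
    then obtain d where "d \<in> data_space" "p = wave_plus \<gamma> d" by blast
    with solution[OF \<gamma>, of d] obtain A where "is_global_solution \<gamma> A" "p = (A 0, time_deriv A 0)"
      by auto
    then show "p \<in> data_space"
      by (auto simp: data_space_def is_global_solution_def)
  qed
  have inj: "inj_on (wave_plus \<gamma>) data_space" if \<gamma>: "\<gamma> > 4/3"
  proof (rule inj_onI)
    fix d d' assume dd: "d \<in> data_space" "d' \<in> data_space" "wave_plus \<gamma> d = wave_plus \<gamma> d'"
    obtain A where A: "is_global_solution \<gamma> A" "asymptotic_to A (fst d) (snd d)"
      "wave_plus \<gamma> d = (A 0, time_deriv A 0)" using solution[OF \<gamma> dd(1)] by blast
    obtain A' where A': "is_global_solution \<gamma> A'" "asymptotic_to A' (fst d') (snd d')"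
      "wave_plus \<gamma> d' = (A' 0, time_deriv A' 0)" using solution[OF \<gamma> dd(2)] by blast
    have "A 0 = A' 0" "time_deriv A 0 = time_deriv A' 0" using A(3) A'(3) dd(3) by auto
    from motion_unique[OF global_solution_imp_motion[OF A(1)] global_solution_imp_motion[OF A'(1)] this]
    have "A = A'" by auto
    then show "d = d'"
      using asymptotic_data_unique A(2) A'(2) by (metis prod_eqI)
  qed
  have onto: "data_space \<subseteq> wave_plus \<gamma> ` data_space" if \<gamma>: "4/3 < \<gamma>" "\<gamma> < 2"
  proof
    fix p assume p: "p \<in> data_space"
    then have "fst p \<in> GL_plus" by (auto simp: data_space_def)
    then obtain A V where A: "motion (\<lambda>_. 1) \<gamma> UNIV A V" "A 0 = fst p" "V 0 = snd p"
      using motion_exists[of \<gamma> "fst p" 0 "snd p"] \<gamma> by auto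
    obtain A1 A0 where A1: "A1 \<in> GL_plus" and as: "asymptotic_to A A1 A0"
      using motion_has_asymptotic_data[OF A(1) \<gamma>] by blast
    have "wave_plus \<gamma> (A1, A0) = p"
      using wave_plus_eq[OF \<gamma>(1) A1 motion_imp_global_solution(1)[OF A(1)] as]
        motion_imp_global_solution(2)[OF A(1)] A(2,3) by simp
    moreover have "(A1, A0) \<in> data_space" using A1 by (simp add: data_space_def)
    ultimately show "p \<in> wave_plus \<gamma> ` data_space" by force
  qed
  show ?thesis
    using ex1 into inj onto by (auto simp: bij_betw_def)
qed

end
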